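(* Let $\Omega\subseteq\mathbb{R}^d$ be a bounded open set, $\mu>0$, $p\ge 2$ and $q=p/(p-1)$. Let $\mathcal{A}:L^2(\Omega)\to L^2(\Omega)$ be bounded and linear and such that $\mathcal{A}^*\mathcal{A}$ is order-preserving, i.e. for all $u\in L^2(\Omega)$ and $x\in\Omega$, $\mathrm{sign}(\mathcal{A}^*\mathcal{A}u(x))=\mathrm{sign}(u(x))$. Let $K:[0,\infty)\to[0,\infty)$ be bounded in $L^\infty$, and let $f\in L^p(\Omega)$. Then the evolution operator $\mathcal{E}^K_{\mathcal{A},f}:L^p(\Omega)\to L^q(\Omega)$, $$\mathcal{E}^K_{\mathcal{A},f}(u)=\mu\Delta_p^K u+\mathcal{A}^*\mathcal{A}u-f,$$ is completely accretive and satisfies the range condition $L^p(\Omega)\subseteq \mathrm{ran}(\mathrm{Id}+\lambda\mathcal{E}^K_{\mathcal{A},f})$ for $\lambda>0$.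
   Context: The nonlocal $p$-Laplacian is $\Delta_p^K u(x)=-\int_\Omega K(|x-y|)\,|u(y)-u(x)|^{p-2}(u(y)-u(x))\,dy$. Pointwise statements about elements of Lebesgue spaces are understood almost everywhere. Let $\mathcal{J}$ be the set of convex, lower semicontinuous $j:\mathbb{R}\to[0,\infty]$ with $j(0)=0$. For measurable $v,w:\Omega\to\mathbb{R}$ write $v\ll^{\mathrm{sgt}} w$ if $\int_\Omega j(v)\,dx\le\int_\Omega j(w)\,dx$ for all $j\in\mathcal{J}$. An operator $A$ on the measurable functions on $\Omega$, with graph $\mathrm{gph}(A)=\{(v,\hat v):\hat v\in Av\}$, is completely accretive if $v-w\ll^{\mathrm{sgt}} v-w+\lambda(\hat v-\hat w)$ for all $\lambda>0$ and all $(v,\hat v),(w,\hat w)\in\mathrm{gph}(A)$. The range of an operator $A$ is $\mathrm{ran}(A)=\{y: y\in Av \text{ for some } v\}$. *)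

theory Defs
  imports "HOL-Analysis.Analysis"
begin

text \<open>
  Elements of Lebesgue spaces over \<open>\<Omega>\<close> are represented by functions on the whole ambient space;
  only their values on \<open>\<Omega>\<close> matter, and they are compared almost everywhere with respect to
  \<^term>\<open>lebesgue_on \<Omega>\<close>. All definitions below are insensitive to the choice of representatives.
\<close>

definition Lp :: "real \<Rightarrow> 'a::euclidean_space set \<Rightarrow> ('a \<Rightarrow> real) set" where
  "Lp p \<Omega> = {u \<in> borel_measurable (lebesgue_on \<Omega>).
                integrable (lebesgue_on \<Omega>) (\<lambda>x. \<bar>u x\<bar> powr p)}"

definition Lp_norm :: "real \<Rightarrow> 'a::euclidean_space set \<Rightarrow> ('a \<Rightarrow> real) \<Rightarrow> real" where
  "Lp_norm p \<Omega> u = (LINT x|lebesgue_on \<Omega>. \<bar>u x\<bar> powr p) powr (1 / p)"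

definition Linfty :: "'a::euclidean_space set \<Rightarrow> ('a \<Rightarrow> real) set" where
  "Linfty \<Omega> = {u \<in> borel_measurable (lebesgue_on \<Omega>).
                 \<exists>C. AE x in lebesgue_on \<Omega>. \<bar>u x\<bar> \<le> C}"

definition ae_eq :: "'a::euclidean_space set \<Rightarrow> ('a \<Rightarrow> real) \<Rightarrow> ('a \<Rightarrow> real) \<Rightarrow> bool" where
  "ae_eq \<Omega> u v \<longleftrightarrow> (AE x in lebesgue_on \<Omega>. u x = v x)"

text \<open>
  \<open>T\<close> acts on representatives; this says that it induces a map of equivalence classes
  from \<^term>\<open>Lp p \<Omega>\<close> to \<^term>\<open>Lp q \<Omega>\<close>.
\<close>

definition Lp_map ::
  "'a::euclidean_space set \<Rightarrow> real \<Rightarrow> real \<Rightarrow> (('a \<Rightarrow> real) \<Rightarrow> ('a \<Rightarrow> real)) \<Rightarrow> bool" where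
  "Lp_map \<Omega> p q T \<longleftrightarrow>
     (\<forall>u \<in> Lp p \<Omega>. T u \<in> Lp q \<Omega>) \<and>
     (\<forall>u \<in> Lp p \<Omega>. \<forall>v \<in> Lp p \<Omega>. ae_eq \<Omega> u v \<longrightarrow> ae_eq \<Omega> (T u) (T v))"

definition L2_bounded_linear ::
  "'a::euclidean_space set \<Rightarrow> (('a \<Rightarrow> real) \<Rightarrow> ('a \<Rightarrow> real)) \<Rightarrow> bool" where
  "L2_bounded_linear \<Omega> A \<longleftrightarrow>
     Lp_map \<Omega> 2 2 A \<and>
     (\<forall>u \<in> Lp 2 \<Omega>. \<forall>v \<in> Lp 2 \<Omega>. \<forall>a b.
        ae_eq \<Omega> (A (\<lambda>x. a * u x + b * v x)) (\<lambda>x. a * A u x + b * A v x)) \<and>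
     (\<exists>C. \<forall>u \<in> Lp 2 \<Omega>. Lp_norm 2 \<Omega> (A u) \<le> C * Lp_norm 2 \<Omega> u)"

text \<open>The adjoint is determined up to almost everywhere equality, hence a predicate.\<close>

definition L2_adjoint ::
  "'a::euclidean_space set \<Rightarrow> (('a \<Rightarrow> real) \<Rightarrow> ('a \<Rightarrow> real)) \<Rightarrow>
     (('a \<Rightarrow> real) \<Rightarrow> ('a \<Rightarrow> real)) \<Rightarrow> bool" where
  "L2_adjoint \<Omega> A As \<longleftrightarrow>
     Lp_map \<Omega> 2 2 As \<and>
     (\<forall>u \<in> Lp 2 \<Omega>. \<forall>v \<in> Lp 2 \<Omega>.
        (LINT x|lebesgue_on \<Omega>. A u x * v x) = (LINT x|lebesgue_on \<Omega>. u x * As v x))"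

definition order_preserving ::
  "'a::euclidean_space set \<Rightarrow> (('a \<Rightarrow> real) \<Rightarrow> ('a \<Rightarrow> real)) \<Rightarrow> bool" where
  "order_preserving \<Omega> B \<longleftrightarrow>
     (\<forall>u \<in> Lp 2 \<Omega>. AE x in lebesgue_on \<Omega>. sgn (B u x) = sgn (u x))"

text \<open>
  For \<open>p = 2\<close>, \<open>0 powr 0 = 0\<close> is harmless: the other factor \<open>u y - u x\<close> vanishes there.
  For \<open>u\<close> in \<^term>\<open>Lp p \<Omega>\<close>, bounded \<open>\<Omega>\<close> and essentially bounded \<open>K\<close> the integrand is integrable for
  almost every \<open>x\<close>, so the default value of a divergent integral matters only on a null set.
\<close>

definition nonlocal_p_laplacian ::
  "'a::euclidean_space set \<Rightarrow> real \<Rightarrow> (real \<Rightarrow> real) \<Rightarrow> ('a \<Rightarrow> real) \<Rightarrow> 'a \<Rightarrow> real" where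
  "nonlocal_p_laplacian \<Omega> p K u x =
     - (LINT y|lebesgue_on \<Omega>. K (norm (x - y)) * \<bar>u y - u x\<bar> powr (p - 2) * (u y - u x))"

definition evolution_operator ::
  "'a::euclidean_space set \<Rightarrow> real \<Rightarrow> real \<Rightarrow> (real \<Rightarrow> real) \<Rightarrow>
     (('a \<Rightarrow> real) \<Rightarrow> ('a \<Rightarrow> real)) \<Rightarrow> (('a \<Rightarrow> real) \<Rightarrow> ('a \<Rightarrow> real)) \<Rightarrow>
     ('a \<Rightarrow> real) \<Rightarrow> ('a \<Rightarrow> real) \<Rightarrow> 'a \<Rightarrow> real" where
  "evolution_operator \<Omega> \<mu> p K A As f u =
     (\<lambda>x. \<mu> * nonlocal_p_laplacian \<Omega> p K u x + As (A u) x - f x)"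

text \<open>
  Operators on measurable functions are set-valued. A single-valued map from
  \<^term>\<open>Lp p \<Omega>\<close> to \<^term>\<open>Lp q \<Omega>\<close> becomes the operator with domain \<^term>\<open>Lp p \<Omega>\<close> that assigns to
  \<open>u\<close> all representatives of the class of \<open>T u\<close>.
\<close>

type_synonym 'a operator = "('a \<Rightarrow> real) \<Rightarrow> ('a \<Rightarrow> real) set"

definition operator_of ::
  "'a::euclidean_space set \<Rightarrow> real \<Rightarrow> real \<Rightarrow> (('a \<Rightarrow> real) \<Rightarrow> ('a \<Rightarrow> real)) \<Rightarrow> 'a operator" where
  "operator_of \<Omega> p q T u = {w \<in> Lp q \<Omega>. u \<in> Lp p \<Omega> \<and> ae_eq \<Omega> w (T u)}"

definition gph :: "'a operator \<Rightarrow> (('a \<Rightarrow> real) \<times> ('a \<Rightarrow> real)) set" where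
  "gph B = {(v, v'). v' \<in> B v}"

definition op_ran :: "'a operator \<Rightarrow> ('a \<Rightarrow> real) set" where
  "op_ran B = {y. \<exists>v. y \<in> B v}"

definition Id_plus :: "real \<Rightarrow> 'a operator \<Rightarrow> 'a operator" where
  "Id_plus l B v = {(\<lambda>x. v x + l * v' x) | v'. v' \<in> B v}"

definition convex_lsc_class :: "(real \<Rightarrow> ennreal) set" where
  "convex_lsc_class = {j.
     (\<forall>x y t. 0 \<le> t \<and> t \<le> 1 \<longrightarrow>
        j ((1 - t) * x + t * y) \<le> ennreal (1 - t) * j x + ennreal t * j y) \<and>
     (\<forall>x. j x \<le> Liminf (at x) j) \<and>
     j 0 = 0}"

definition sgt_le :: "'a::euclidean_space set \<Rightarrow> ('a \<Rightarrow> real) \<Rightarrow> ('a \<Rightarrow> real) \<Rightarrow> bool" where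
  "sgt_le \<Omega> v w \<longleftrightarrow>
     (\<forall>j \<in> convex_lsc_class.
        (\<integral>\<^sup>+ x. j (v x) \<partial>lebesgue_on \<Omega>) \<le> (\<integral>\<^sup>+ x. j (w x) \<partial>lebesgue_on \<Omega>))"

definition completely_accretive :: "'a::euclidean_space set \<Rightarrow> 'a operator \<Rightarrow> bool" where
  "completely_accretive \<Omega> B \<longleftrightarrow>
     (\<forall>l > 0. \<forall>(v, v') \<in> gph B. \<forall>(w, w') \<in> gph B.
        sgt_le \<Omega> (\<lambda>x. v x - w x) (\<lambda>x. v x - w x + l * (v' x - w' x)))"

end

theory Submission
  imports Defs
begin

text \<open>
  Write \<open>B = A\<^sup>* A\<close>. Preserving the sign of every function forces \<open>B\<close> to be a multiplication
  operator: the sign of \<open>u - c\<close> is that of \<open>B u - c (B 1)\<close> for every rational \<open>c\<close> at almost every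
  point, so \<open>u\<close> and \<open>B u / B 1\<close> lie on the same side of every rational and coincide
  (\<open>order_preserving_multiplication\<close>). Up to \<open>f\<close>, the evolution operator is therefore
  \<open>u \<mapsto> \<mu> \<Delta> u + m u\<close> with \<open>m \<ge> 0\<close>, and both claims are statements about a finite measure
  space with a bounded, nonnegative, symmetric kernel. They are proved in that generality, in the
  locale \<open>nonlocal_equation\<close>. The kernel \<open>K(\<bar>x - y\<bar>)\<close> fits in after \<open>K\<close> has been replaced by a
  bounded Borel function. This leaves the operator unchanged because \<open>y \<mapsto> \<bar>x - y\<bar>\<close> pulls
  null sets back to null sets (\<open>AE_dist_notin_null_set\<close>).

  Complete accretivity (\<open>oper_contraction\<close>). If \<open>j\<close> is convex and Lipschitz, with a monotone
  bounded selection \<open>g\<close> of its subdifferential, then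
  \<open>\<integral> j (a + l b) \<ge> \<integral> j a + l \<integral> g(a) b\<close>, where \<open>a = u - v\<close> and \<open>b\<close> is the difference of the
  images of \<open>u\<close> and \<open>v\<close>. The last integral is nonnegative. The multiplication part contributes
  \<open>m g(a) a \<ge> 0\<close>, since \<open>j\<close> is minimal at 0. The nonlocal part is symmetrized in \<open>(x, y)\<close>, which
  turns it into the integral of a product of two differences of equal sign, because the flux
  \<open>t \<mapsto> \<bar>t\<bar>\<^sup>p\<^sup>-\<^sup>2 t\<close> and \<open>g\<close> are both monotone (\<open>lap_pairing_nonneg\<close>). A general \<open>j\<close> is the
  increasing limit of its inf-convolutions with \<open>n \<bar>t\<bar>\<close>, which are convex and \<open>n\<close>-Lipschitz
  (\<open>SUP_regularization\<close>), so monotone convergence finishes the argument.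

  Range condition (\<open>resolvent_solvable\<close>). The equation to be solved is
  \<open>u + l (\<mu> \<Delta> u + m u) = H\<close>. For bounded \<open>H\<close>, a multiple of \<open>u\<close> large enough to dominate the
  local Lipschitz constant of the flux is added to both sides; the equation becomes \<open>u = T u\<close> with
  \<open>T\<close> order-preserving on \<open>{\<bar>u\<bar> \<le> N}\<close>. Iteration from the subsolution \<open>- N\<close> increases to
  a solution (\<open>solvable_bounded\<close>). For general \<open>H\<close>, the contraction estimate with
  \<open>j t = max 0 t\<close> makes solutions monotone in the data, and with \<open>j t = \<bar>t\<bar>\<^sup>p\<close> bounds them
  in \<open>L\<^sup>p\<close>. Hence solvability survives increasing limits of data
  (\<open>solvable_incseq_limit\<close>). Since the equation is odd, one such limit removes the
  upper truncation of \<open>H\<close> and another, applied to \<open>- H\<close>, removes the lower one.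
\<close>

section \<open>The scalar flux\<close>

definition pflux :: "real \<Rightarrow> real \<Rightarrow> real" where
  "pflux p t = \<bar>t\<bar> powr (p - 2) * t"

text \<open>
  Splitting into positive and negative part removes the singular factor
  \<open>\<bar>t\<bar> powr (p - 2)\<close>; monotonicity, continuity and the Lipschitz bound are inherited from
  \<open>t \<mapsto> t powr (p - 1)\<close> on the nonnegative reals.
\<close>

lemma pflux_eq: "pflux p t = max 0 t powr (p - 1) - max 0 (- t) powr (p - 1)"
proof (cases t "0::real" rule: linorder_cases)
  case less
  have "(-t) powr (p - 1) = (-t) powr (p - 2) * (-t)"
    using less powr_add[of "-t" "p - 2" 1] by simp
  then show ?thesis using less by (simp add: pflux_def)
next
  case greater
  have "t powr (p - 1) = t powr (p - 2) * t"
    using greater powr_add[of t "p - 2" 1] by simp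
  then show ?thesis using greater by (simp add: pflux_def)
qed (simp add: pflux_def)

lemma pflux_0 [simp]: "pflux p 0 = 0"
  by (simp add: pflux_def)

lemma pflux_minus: "pflux p (- t) = - pflux p t"
  by (simp add: pflux_def)

lemma abs_pflux: "\<bar>pflux p t\<bar> = \<bar>t\<bar> powr (p - 1)"
  by (cases t "0::real" rule: linorder_cases) (simp_all add: pflux_eq)

lemma pflux_mono: "1 \<le> p \<Longrightarrow> s \<le> t \<Longrightarrow> pflux p s \<le> pflux p t"
  unfolding pflux_eq by (intro diff_mono powr_mono2) auto

lemma continuous_pflux: "1 < p \<Longrightarrow> continuous_on UNIV (pflux p)"
  unfolding pflux_eq by (intro continuous_intros continuous_on_powr') auto

lemma borel_measurable_pflux [measurable]: "pflux p \<in> borel_measurable borel"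
  unfolding pflux_def by measurable

lemma powr_diff_le:
  fixes a b R r :: real
  assumes "0 \<le> a" "a \<le> b" "b \<le> R" "1 \<le> r"
  shows "b powr r - a powr r \<le> r * R powr (r - 1) * (b - a)"
proof -
  consider "a = b" | "a = 0" "a < b" | "0 < a" "a < b" using assms by linarith
  then show ?thesis
  proof cases
    case 2
    have "b powr r = b powr (r - 1) * b"
      using 2 powr_add[of b "r - 1" 1] by simp
    also have "\<dots> \<le> R powr (r - 1) * b"
      using assms 2 by (intro mult_right_mono powr_mono2) auto
    also have "\<dots> \<le> r * R powr (r - 1) * b"
      using assms 2 by (intro mult_right_mono) auto
    finally show ?thesis using 2 by simp
  next
    case 3
    have "\<exists>z>a. z < b \<and> b powr r - a powr r = (b - a) * (r * z powr (r - 1))"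
      using 3 by (intro MVT2) (auto intro!: DERIV_powr derivative_eq_intros)
    then obtain z where z: "a < z" "z < b" "b powr r - a powr r = (b - a) * (r * z powr (r - 1))"
      by auto
    have "z powr (r - 1) \<le> R powr (r - 1)"
      using z 3 assms by (intro powr_mono2) auto
    then have "(b - a) * (r * z powr (r - 1)) \<le> (b - a) * (r * R powr (r - 1))"
      using 3 assms by (intro mult_left_mono) auto
    then show ?thesis using z by (simp add: mult_ac)
  qed simp
qed

lemma pflux_lipschitz:
  assumes "2 \<le> p" "s \<le> t" "\<bar>s\<bar> \<le> R" "\<bar>t\<bar> \<le> R"
  shows "pflux p t - pflux p s \<le> (p - 1) * R powr (p - 2) * (t - s)"
proof -
  have "max 0 t powr (p - 1) - max 0 s powr (p - 1)
      \<le> (p - 1) * R powr (p - 1 - 1) * (max 0 t - max 0 s)"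
    using assms by (intro powr_diff_le) auto
  moreover have "max 0 (-s) powr (p - 1) - max 0 (-t) powr (p - 1)
      \<le> (p - 1) * R powr (p - 1 - 1) * (max 0 (-s) - max 0 (-t))"
    using assms by (intro powr_diff_le) auto
  moreover have "(max 0 t - max 0 s) + (max 0 (-s) - max 0 (-t)) = t - s" by auto
  ultimately show ?thesis
    unfolding pflux_eq
    by (smt (verit, best) distrib_left)
qed

lemma powr_add_le:
  fixes s t r :: real
  assumes "0 \<le> r"
  shows "\<bar>s + t\<bar> powr r \<le> 2 powr r * (\<bar>s\<bar> powr r + \<bar>t\<bar> powr r)"
proof -
  have "\<bar>s + t\<bar> powr r \<le> (2 * max \<bar>s\<bar> \<bar>t\<bar>) powr r"
    using assms by (intro powr_mono2) auto
  also have "\<dots> = 2 powr r * max \<bar>s\<bar> \<bar>t\<bar> powr r" by (simp add: powr_mult)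
  also have "max \<bar>s\<bar> \<bar>t\<bar> powr r \<le> \<bar>s\<bar> powr r + \<bar>t\<bar> powr r" by (auto simp: max_def)
  finally show ?thesis by simp
qed

lemma powr_le_one_plus_powr:
  fixes t r p :: real
  assumes "0 \<le> r" "r \<le> p"
  shows "\<bar>t\<bar> powr r \<le> 1 + \<bar>t\<bar> powr p"
proof (cases "\<bar>t\<bar> \<le> 1")
  case True
  then have "\<bar>t\<bar> powr r \<le> 1" using assms by (intro powr_le1) auto
  then show ?thesis by (smt (verit) powr_ge_zero)
next
  case False
  then have "\<bar>t\<bar> powr r \<le> \<bar>t\<bar> powr p" using assms by (intro powr_mono) auto
  then show ?thesis by simp
qed

text \<open>
  Trading the exponent \<open>p - 1\<close> for \<open>p\<close> gives a majorant of the flux that is a sum of functions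
  of one variable, integrable as soon as \<open>\<bar>u\<bar>\<^sup>p\<close> is.
\<close>

lemma abs_pflux_diff_le:
  assumes "1 \<le> p"
  shows "\<bar>pflux p (t - s)\<bar> \<le> 2 powr (p - 1) * (2 + \<bar>t\<bar> powr p + \<bar>s\<bar> powr p)"
proof -
  have "\<bar>pflux p (t - s)\<bar> \<le> 2 powr (p - 1) * (\<bar>t\<bar> powr (p - 1) + \<bar>-s\<bar> powr (p - 1))"
    using powr_add_le[of "p - 1" t "-s"] assms by (simp add: abs_pflux)
  also have "\<dots> \<le> 2 powr (p - 1) * ((1 + \<bar>t\<bar> powr p) + (1 + \<bar>-s\<bar> powr p))"
    using assms by (intro mult_left_mono add_mono powr_le_one_plus_powr) auto
  finally show ?thesis by (simp add: algebra_simps)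
qed

section \<open>Lipschitz regularization of convex functions\<close>

text \<open>
  Inf-convolution with \<open>n \<bar>t\<bar>\<close>: the largest \<open>n\<close>-Lipschitz minorant. Unlike a convex
  lower semicontinuous function, which may be infinite or have vertical tangents at the ends of its
  domain, it has bounded subgradients.
\<close>

definition lipschitz_regularization :: "(real \<Rightarrow> ennreal) \<Rightarrow> nat \<Rightarrow> real \<Rightarrow> ennreal" where
  "lipschitz_regularization j n x = (INF y. j y + ennreal (real n * \<bar>x - y\<bar>))"

lemma regularization_le: "lipschitz_regularization j n x \<le> j x"
  unfolding lipschitz_regularization_def by (rule INF_lower2[of x]) auto

lemma regularization_le_linear:
  "j 0 = 0 \<Longrightarrow> lipschitz_regularization j n x \<le> ennreal (real n * \<bar>x\<bar>)"
  unfolding lipschitz_regularization_def by (rule INF_lower2[of 0]) auto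

lemma incseq_regularization: "incseq (\<lambda>n. lipschitz_regularization j n x)"
  unfolding lipschitz_regularization_def
  by (intro monoI INF_superset_mono subset_refl add_left_mono ennreal_leI mult_right_mono) auto

text \<open>
  Below a given \<open>c < j x\<close>, points \<open>y\<close> near \<open>x\<close> are harmless by lower semicontinuity, and for
  the others the penalty \<open>n \<bar>x - y\<bar>\<close> exceeds \<open>c\<close> once \<open>n\<close> is large.
\<close>

lemma SUP_regularization:
  assumes "j \<in> convex_lsc_class"
  shows "(SUP n. lipschitz_regularization j n x) = j x"
proof (rule antisym)
  show "(SUP n. lipschitz_regularization j n x) \<le> j x"
    by (intro SUP_least regularization_le)
  show "j x \<le> (SUP n. lipschitz_regularization j n x)"
  proof (rule dense_le)
    fix c assume c: "c < j x"
    also have "j x \<le> Liminf (at x) j" using assms by (auto simp: convex_lsc_class_def)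
    finally have "eventually (\<lambda>y. c < j y) (at x)" by (rule less_LiminfD)
    then obtain d where d: "d > 0" "\<And>y. y \<noteq> x \<Longrightarrow> dist y x < d \<Longrightarrow> c < j y"
      by (auto simp: eventually_at)
    have "c < top" using c by (rule order_less_le_trans) simp
    then obtain r where r: "c = ennreal r" "r \<ge> 0" by (cases c) auto
    (* With this n the penalty reaches r at distance d. *)
    obtain n :: nat where n: "r / d \<le> real n" using real_arch_simple by blast
    have "c \<le> j y + ennreal (real n * \<bar>x - y\<bar>)" for y
    proof (cases "dist y x < d")
      case True
      then have "c \<le> j y" using c d(2)[of y] by (cases "y = x") auto
      then show ?thesis by (rule order_trans) simp
    next
      case False
      have "r \<le> real n * d" using n d by (simp add: field_simps)
      also have "\<dots> \<le> real n * \<bar>x - y\<bar>" using False by (intro mult_left_mono) (auto simp: dist_real_def)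
      finally have "c \<le> ennreal (real n * \<bar>x - y\<bar>)" unfolding r by (rule ennreal_leI)
      then show ?thesis by (simp add: add_increasing)
    qed
    then have "c \<le> lipschitz_regularization j n x"
      unfolding lipschitz_regularization_def by (intro INF_greatest)
    then show "c \<le> (SUP n. lipschitz_regularization j n x)" by (rule SUP_upper2[OF UNIV_I])
  qed
qed

text \<open>
  The point \<open>y = 0\<close> is always a competitor, so the inf-convolution is finite and may be handled
  as a real function. Convexity holds because convex combinations of near-minimizers for two points
  compete for the combined point.
\<close>

lemma regularization_real:
  assumes j: "j \<in> convex_lsc_class"
  obtains h where "\<And>x. lipschitz_regularization j n x = ennreal (h x)" "\<And>x. 0 \<le> h x" "h 0 = 0"
    "\<And>x y. h x \<le> h y + real n * \<bar>x - y\<bar>" "convex_on UNIV h"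
proof -
  have j0: "j 0 = 0" and jconv: "\<And>x y t. 0 \<le> t \<Longrightarrow> t \<le> 1 \<Longrightarrow>
        j ((1 - t) * x + t * y) \<le> ennreal (1 - t) * j x + ennreal t * j y"
    using j by (auto simp: convex_lsc_class_def)
  define h where "h x = enn2real (lipschitz_regularization j n x)" for x
  have h: "lipschitz_regularization j n x = ennreal (h x)" for x
    unfolding h_def using regularization_le_linear[of j n x, OF j0]
    by (metis ennreal_enn2real ennreal_less_top order_le_less_trans)
  have h0: "0 \<le> h x" for x by (simp add: h_def)
  have le: "h x \<le> r + real n * \<bar>x - y\<bar>" if "j y \<le> ennreal r" "0 \<le> r" for x y r
  proof -
    have "ennreal (h x) \<le> j y + ennreal (real n * \<bar>x - y\<bar>)"
      unfolding h[symmetric] lipschitz_regularization_def by (rule INF_lower) simp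
    also have "\<dots> \<le> ennreal r + ennreal (real n * \<bar>x - y\<bar>)" using that by (intro add_right_mono)
    also have "\<dots> = ennreal (r + real n * \<bar>x - y\<bar>)" using that by simp
    finally show ?thesis using that by (subst (asm) ennreal_le_iff) auto
  qed
  have ex: "\<exists>y r. j y = ennreal r \<and> 0 \<le> r \<and> r + real n * \<bar>x - y\<bar> < h x + e" if "e > 0" for x e
  proof -
    have "lipschitz_regularization j n x < ennreal (h x + e)"
      unfolding h using that h0[of x] by (intro ennreal_lessI) auto
    then obtain y where y: "j y + ennreal (real n * \<bar>x - y\<bar>) < ennreal (h x + e)"
      unfolding lipschitz_regularization_def by (auto simp: INF_less_iff)
    then obtain r where r: "j y = ennreal r" "0 \<le> r" by (cases "j y") auto
    have "ennreal (r + real n * \<bar>x - y\<bar>) < ennreal (h x + e)" using y r by simp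
    then have "r + real n * \<bar>x - y\<bar> < h x + e" using r by (subst (asm) ennreal_less_iff) auto
    then show ?thesis using r by blast
  qed
  have lip: "h x \<le> h z + real n * \<bar>x - z\<bar>" for x z
  proof (rule field_le_epsilon)
    fix e :: real assume "0 < e"
    then obtain y r where y: "j y = ennreal r" "0 \<le> r" "r + real n * \<bar>z - y\<bar> < h z + e"
      using ex by blast
    have "h x \<le> r + real n * \<bar>x - y\<bar>" using y by (intro le) auto
    also have "real n * \<bar>x - y\<bar> \<le> real n * (\<bar>x - z\<bar> + \<bar>z - y\<bar>)" by (intro mult_left_mono) auto
    finally show "h x \<le> h z + real n * \<bar>x - z\<bar> + e" using y by (simp add: algebra_simps)
  qed
  have conv: "h ((1 - t) * x1 + t * x2) \<le> (1 - t) * h x1 + t * h x2" if t: "0 \<le> t" "t \<le> 1" for t x1 x2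
  proof (rule field_le_epsilon)
    fix e :: real assume e: "0 < e"
    obtain y1 r1 where y1: "j y1 = ennreal r1" "0 \<le> r1" "r1 + real n * \<bar>x1 - y1\<bar> < h x1 + e"
      using ex e by blast
    obtain y2 r2 where y2: "j y2 = ennreal r2" "0 \<le> r2" "r2 + real n * \<bar>x2 - y2\<bar> < h x2 + e"
      using ex e by blast
    let ?x = "(1 - t) * x1 + t * x2" and ?y = "(1 - t) * y1 + t * y2"
    have "j ?y \<le> ennreal (1 - t) * ennreal r1 + ennreal t * ennreal r2"
      using jconv[OF t, of y1 y2] y1 y2 by simp
    also have "\<dots> = ennreal ((1 - t) * r1 + t * r2)"
      using t y1 y2 by (simp add: ennreal_mult)
    finally have "h ?x \<le> (1 - t) * r1 + t * r2 + real n * \<bar>?x - ?y\<bar>"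
      using t y1 y2 by (intro le) auto
    also have "real n * \<bar>?x - ?y\<bar> \<le> real n * ((1 - t) * \<bar>x1 - y1\<bar> + t * \<bar>x2 - y2\<bar>)"
    proof (intro mult_left_mono)
      have "\<bar>?x - ?y\<bar> = \<bar>(1 - t) * (x1 - y1) + t * (x2 - y2)\<bar>" by (simp add: algebra_simps)
      also have "\<dots> \<le> \<bar>(1 - t) * (x1 - y1)\<bar> + \<bar>t * (x2 - y2)\<bar>" by (rule abs_triangle_ineq)
      finally show "\<bar>?x - ?y\<bar> \<le> (1 - t) * \<bar>x1 - y1\<bar> + t * \<bar>x2 - y2\<bar>"
        using t by (simp add: abs_mult)
    qed simp
    finally have "h ?x \<le> (1 - t) * (r1 + real n * \<bar>x1 - y1\<bar>) + t * (r2 + real n * \<bar>x2 - y2\<bar>)"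
      by (simp add: algebra_simps)
    also have "\<dots> \<le> (1 - t) * (h x1 + e) + t * (h x2 + e)"
      using t y1 y2 by (intro add_mono[OF mult_left_mono mult_left_mono]) auto
    finally show "h ?x \<le> (1 - t) * h x1 + t * h x2 + e" by (simp add: algebra_simps)
  qed
  have "h 0 = 0" using le[of 0 0 0] j0 h0[of 0] by simp
  moreover have "convex_on UNIV h"
    by (intro convex_onI) (auto simp: conv less_imp_le)
  ultimately show ?thesis using h h0 lip that by blast
qed

text \<open>
  The right derivative is a selection of the subdifferential; monotonicity and the bound follow
  from the subgradient inequality alone.
\<close>

lemma convex_subgradient:
  fixes h :: "real \<Rightarrow> real"
  assumes "convex_on UNIV h" "\<And>x y. h x \<le> h y + L * \<bar>x - y\<bar>"
  obtains g where "\<And>x y. h x + g x * (y - x) \<le> h y" "mono g" "\<And>x. \<bar>g x\<bar> \<le> L"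
proof -
  define g where "g x = Inf ((\<lambda>t. (h x - h t) / (x - t)) ` ({x<..} \<inter> UNIV))" for x
  have g: "h x + g x * (y - x) \<le> h y" for x y
    using convex_le_Inf_differential[OF assms(1), of x y] by (simp add: g_def)
  have "mono g"
  proof (rule monoI)
    fix x y :: real assume "x \<le> y"
    show "g x \<le> g y"
    proof (cases "x = y")
      case False
      then have "0 < y - x" using \<open>x \<le> y\<close> by simp
      moreover have "(g x - g y) * (y - x) \<le> 0"
        using g[of x y] g[of y x] by (simp add: algebra_simps)
      ultimately show ?thesis by (simp add: mult_le_0_iff)
    qed simp
  qed
  moreover have "\<bar>g x\<bar> \<le> L" for x
    using g[of x "x + 1"] g[of x "x - 1"] assms(2)[of "x+1" x] assms(2)[of "x-1" x]
    by (simp add: abs_le_iff)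
  ultimately show ?thesis using g that by blast
qed

lemma convex_on_max_0: "convex_on UNIV (\<lambda>t::real. max 0 t)"
proof (rule convex_onI)
  fix t x y :: real assume t: "0 < t" "t < 1"
  have "(1 - t) * x \<le> (1 - t) * max 0 x" "t * y \<le> t * max 0 y"
    "0 \<le> (1 - t) * max 0 x" "0 \<le> t * max 0 y"
    using t by (auto intro!: mult_left_mono)
  then show "max 0 ((1 - t) *\<^sub>R x + t *\<^sub>R y) \<le> (1 - t) * max 0 x + t * max 0 y" by simp
qed simp

lemma powr_convex_comb_le:
  fixes a b t p :: real
  assumes "0 \<le> a" "0 \<le> b" "0 < t" "t < 1" "1 \<le> p"
  shows "((1 - t) * a + t * b) powr p \<le> (1 - t) * a powr p + t * b powr p"
proof -
  have scaled: "(s * c) powr p \<le> s * c powr p" if "0 < s" "s < 1" for s c :: real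
  proof -
    have "s powr p \<le> s powr 1" using that assms by (intro powr_mono') auto
    then show ?thesis using that by (simp add: powr_mult mult_right_mono)
  qed
  consider "a = 0" | "b = 0" | "0 < a" "0 < b" using assms by linarith
  then show ?thesis
  proof cases
    case 1
    then show ?thesis using scaled[of t b] assms by simp
  next
    case 2
    then show ?thesis using scaled[of "1 - t" a] assms by simp
  next
    case 3
    then show ?thesis
      using convex_onD[OF powr_convex[OF \<open>1 \<le> p\<close>], of t a b] assms by simp
  qed
qed

lemma convex_on_abs_powr:
  assumes "1 \<le> p"
  shows "convex_on UNIV (\<lambda>t::real. \<bar>t\<bar> powr p)"
proof (rule convex_onI)
  fix t x y :: real assume t: "0 < t" "t < 1"
  have "\<bar>(1 - t) *\<^sub>R x + t *\<^sub>R y\<bar> \<le> (1 - t) * \<bar>x\<bar> + t * \<bar>y\<bar>"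
    using abs_triangle_ineq[of "(1 - t) * x" "t * y"] t by (simp add: abs_mult)
  then have "\<bar>(1 - t) *\<^sub>R x + t *\<^sub>R y\<bar> powr p \<le> ((1 - t) * \<bar>x\<bar> + t * \<bar>y\<bar>) powr p"
    using assms by (intro powr_mono2) auto
  also have "\<dots> \<le> (1 - t) * \<bar>x\<bar> powr p + t * \<bar>y\<bar> powr p"
    using t assms by (intro powr_convex_comb_le) auto
  finally show "\<bar>(1 - t) *\<^sub>R x + t *\<^sub>R y\<bar> powr p \<le> (1 - t) * \<bar>x\<bar> powr p + t * \<bar>y\<bar> powr p" .
qed simp

text \<open>
  Finite convex functions are continuous, so lower semicontinuity is automatic.
\<close>

lemma ennreal_convex_lsc:
  assumes h: "convex_on UNIV h" "\<And>x. 0 \<le> h x" "h 0 = 0"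
  shows "(\<lambda>x. ennreal (h x)) \<in> convex_lsc_class"
  unfolding convex_lsc_class_def
proof (safe)
  fix x y t :: real assume t: "0 \<le> t" "t \<le> 1"
  have "h ((1 - t) * x + t * y) \<le> (1 - t) * h x + t * h y"
    using convex_onD[OF h(1), of t x y] t by simp
  then have "ennreal (h ((1 - t) * x + t * y)) \<le> ennreal ((1 - t) * h x + t * h y)"
    by (rule ennreal_leI)
  then show "ennreal (h ((1 - t) * x + t * y)) \<le> ennreal (1 - t) * ennreal (h x) + ennreal t * ennreal (h y)"
    using t h(2) by (simp add: ennreal_mult)
next
  fix x
  have "isCont h x" using convex_on_continuous[OF _ h(1)] by (auto simp: continuous_on_eq_continuous_at)
  then have "((\<lambda>y. ennreal (h y)) \<longlongrightarrow> ennreal (h x)) (at x)"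
    by (intro tendsto_ennrealI) (simp add: isCont_def)
  then have "Liminf (at x) (\<lambda>y. ennreal (h y)) = ennreal (h x)"
    by (intro lim_imp_Liminf) auto
  then show "ennreal (h x) \<le> Liminf (at x) (\<lambda>y. ennreal (h y))" by simp
qed (simp add: h)

section \<open>Functions with integrable powers\<close>

text \<open>
  Counterpart of \<^const>\<open>Lp\<close> for an arbitrary measure, so that the operator can be studied
  without reference to the geometry of \<open>\<Omega>\<close>.
\<close>

definition Lp_fun :: "'a measure \<Rightarrow> real \<Rightarrow> ('a \<Rightarrow> real) set" where
  "Lp_fun M p = {u \<in> borel_measurable M. integrable M (\<lambda>x. \<bar>u x\<bar> powr p)}"

lemma Lp_fun_measurable: "u \<in> Lp_fun M p \<Longrightarrow> u \<in> borel_measurable M"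
  by (simp add: Lp_fun_def)

lemma Lp_fun_powr_integrable: "u \<in> Lp_fun M p \<Longrightarrow> integrable M (\<lambda>x. \<bar>u x\<bar> powr p)"
  by (simp add: Lp_fun_def)

lemma Lp_fun_dominated:
  assumes "u \<in> Lp_fun M p" "v \<in> borel_measurable M" "AE x in M. \<bar>v x\<bar> \<le> \<bar>u x\<bar>" "0 \<le> p"
  shows "v \<in> Lp_fun M p"
proof -
  note [measurable] = assms(2)
  have "integrable M (\<lambda>x. \<bar>v x\<bar> powr p)"
  proof (rule Bochner_Integration.integrable_bound[OF Lp_fun_powr_integrable[OF assms(1)]])
    show "AE x in M. norm (\<bar>v x\<bar> powr p) \<le> norm (\<bar>u x\<bar> powr p)"
      using assms(3) by eventually_elim (auto intro!: powr_mono2 assms)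
  qed simp
  then show ?thesis by (simp add: Lp_fun_def assms)
qed

lemma Lp_fun_add:
  assumes "u \<in> Lp_fun M p" "v \<in> Lp_fun M p" "0 \<le> p"
  shows "(\<lambda>x. u x + v x) \<in> Lp_fun M p"
proof -
  note [measurable] = assms(1,2)[THEN Lp_fun_measurable]
  have "integrable M (\<lambda>x. 2 powr p * (\<bar>u x\<bar> powr p + \<bar>v x\<bar> powr p))"
    using assms by (intro integrable_mult_right Bochner_Integration.integrable_add Lp_fun_powr_integrable)
  then have "integrable M (\<lambda>x. \<bar>u x + v x\<bar> powr p)"
    by (rule Bochner_Integration.integrable_bound) (auto intro!: AE_I2 order_trans[OF powr_add_le] assms)
  then show ?thesis by (simp add: Lp_fun_def)
qed

lemma Lp_fun_scale:
  assumes "u \<in> Lp_fun M p"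
  shows "(\<lambda>x. c * u x) \<in> Lp_fun M p"
  using assms unfolding Lp_fun_def by (auto simp: abs_mult powr_mult)

lemma Lp_fun_diff:
  assumes "u \<in> Lp_fun M p" "v \<in> Lp_fun M p" "0 \<le> p"
  shows "(\<lambda>x. u x - v x) \<in> Lp_fun M p"
  using Lp_fun_add[OF assms(1) Lp_fun_scale[OF assms(2), of "-1"] assms(3)] by simp

lemma Lp_fun_abs: "u \<in> Lp_fun M p \<Longrightarrow> (\<lambda>x. \<bar>u x\<bar>) \<in> Lp_fun M p"
  unfolding Lp_fun_def by auto

lemma (in finite_measure) Lp_fun_bounded:
  assumes [measurable]: "u \<in> borel_measurable M" and "AE x in M. \<bar>u x\<bar> \<le> c" "0 \<le> p"
  shows "u \<in> Lp_fun M p"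
proof (rule Lp_fun_dominated)
  show "(\<lambda>x. c) \<in> Lp_fun M p" by (simp add: Lp_fun_def)
  show "AE x in M. \<bar>u x\<bar> \<le> \<bar>c\<bar>" using assms(2) by eventually_elim auto
qed fact+

lemma (in finite_measure) Lp_fun_mono:
  assumes "u \<in> Lp_fun M p" "0 \<le> r" "r \<le> p"
  shows "u \<in> Lp_fun M r"
proof -
  note [measurable] = assms(1)[THEN Lp_fun_measurable]
  have "integrable M (\<lambda>x. 1 + \<bar>u x\<bar> powr p)"
    using assms by (intro Bochner_Integration.integrable_add integrable_const Lp_fun_powr_integrable)
  then have "integrable M (\<lambda>x. \<bar>u x\<bar> powr r)"
    by (rule Bochner_Integration.integrable_bound)
       (use powr_le_one_plus_powr assms in \<open>auto intro!: AE_I2 order_trans[OF powr_le_one_plus_powr[OF assms(2,3)]]\<close>)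
  then show ?thesis by (simp add: Lp_fun_def)
qed

lemma (in finite_measure) Lp_fun_integrable:
  assumes "u \<in> Lp_fun M p" "1 \<le> p"
  shows "integrable M u"
proof -
  have "u \<in> Lp_fun M 1" using assms by (intro Lp_fun_mono[OF assms(1)]) auto
  then show ?thesis unfolding Lp_fun_def using integrable_abs_iff by auto
qed

lemma L2_mult_integrable:
  assumes "u \<in> Lp_fun M 2" "v \<in> Lp_fun M 2"
  shows "integrable M (\<lambda>x. u x * v x)"
proof (rule Bochner_Integration.integrable_bound[of M "\<lambda>x. \<bar>u x\<bar> powr 2 + \<bar>v x\<bar> powr 2"])
  note [measurable] = assms[THEN Lp_fun_measurable]
  show "integrable M (\<lambda>x. \<bar>u x\<bar> powr 2 + \<bar>v x\<bar> powr 2)"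
    using assms by (intro Bochner_Integration.integrable_add Lp_fun_powr_integrable)
  show "(\<lambda>x. u x * v x) \<in> borel_measurable M" by measurable
  have "\<bar>a * b\<bar> \<le> \<bar>a\<bar> powr 2 + \<bar>b\<bar> powr 2" for a b :: real
  proof -
    have "0 \<le> (\<bar>a\<bar> - \<bar>b\<bar>)\<^sup>2" "0 \<le> \<bar>a\<bar> * \<bar>b\<bar>" by simp_all
    then have "\<bar>a\<bar> * \<bar>b\<bar> \<le> \<bar>a\<bar>\<^sup>2 + \<bar>b\<bar>\<^sup>2"
      unfolding power2_diff by linarith
    then show ?thesis by (simp add: abs_mult)
  qed
  then show "AE x in M. norm (u x * v x) \<le> norm (\<bar>u x\<bar> powr 2 + \<bar>v x\<bar> powr 2)"
    by (auto intro!: AE_I2)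
qed

section \<open>Nonlocal operators over a finite measure space\<close>

text \<open>
  The abstract setting. Multiplication by \<open>m\<close> stands for the operator \<open>A\<^sup>* A\<close>. As that operator
  maps \<open>L\<^sup>2\<close> to itself, \<open>m u\<close> is integrable whenever \<open>u\<close> lies in \<open>L\<^sup>p\<close>.
\<close>

locale nonlocal_equation = finite_measure M for M :: "'a measure" +
  fixes k :: "'a \<Rightarrow> 'a \<Rightarrow> real" and C p \<mu> :: real and m :: "'a \<Rightarrow> real"
  assumes k_measurable [measurable]: "(\<lambda>(x, y). k x y) \<in> borel_measurable (M \<Otimes>\<^sub>M M)"
    and k_sym: "k x y = k y x"
    and k_nonneg: "0 \<le> k x y"
    and k_le: "k x y \<le> C"
    and p_ge: "2 \<le> p"
    and mu_pos: "0 < \<mu>"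
    and m_measurable [measurable]: "m \<in> borel_measurable M"
    and m_nonneg: "0 \<le> m x"
    and m_integrable: "u \<in> Lp_fun M p \<Longrightarrow> integrable M (\<lambda>x. m x * u x)"
begin

sublocale pair: pair_sigma_finite M M ..

definition lap :: "('a \<Rightarrow> real) \<Rightarrow> 'a \<Rightarrow> real" where
  "lap u x = - (LINT y|M. k x y * pflux p (u y - u x))"

definition oper :: "('a \<Rightarrow> real) \<Rightarrow> 'a \<Rightarrow> real" where
  "oper u x = \<mu> * lap u x + m x * u x"

lemma C_nonneg: "0 \<le> C"
  using order_trans[OF k_nonneg k_le] .

lemma k_section [measurable]: "x \<in> space M \<Longrightarrow> k x \<in> borel_measurable M"
  using measurable_Pair2[OF k_measurable] by simp

lemma lap_measurable [measurable]:
  assumes [measurable]: "u \<in> borel_measurable M"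
  shows "lap u \<in> borel_measurable M"
  unfolding lap_def by measurable

lemma oper_measurable [measurable]:
  assumes [measurable]: "u \<in> borel_measurable M"
  shows "oper u \<in> borel_measurable M"
  unfolding oper_def by measurable

lemma flux_integrable:
  assumes "u \<in> Lp_fun M p" "x \<in> space M"
  shows "integrable M (\<lambda>y. k x y * pflux p (u y - s))"
proof -
  note [measurable] = assms(1)[THEN Lp_fun_measurable]
  let ?b = "\<lambda>y. C * (2 powr (p - 1) * (2 + \<bar>u y\<bar> powr p + \<bar>s\<bar> powr p))"
  have "integrable M ?b"
    using assms by (intro integrable_mult_right Bochner_Integration.integrable_add integrable_const Lp_fun_powr_integrable)
  then show ?thesis
  proof (rule Bochner_Integration.integrable_bound)
    have "\<bar>k x y * pflux p (u y - s)\<bar> \<le> ?b y" for y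
      unfolding abs_mult using k_nonneg k_le C_nonneg p_ge by (intro mult_mono abs_pflux_diff_le) auto
    then show "AE y in M. norm (k x y * pflux p (u y - s)) \<le> norm (?b y)"
      by (auto intro!: AE_I2 order_trans[OF _ abs_ge_self])
  qed (use assms in measurable)
qed

text \<open>
  The growth \<open>\<bar>t\<bar> powr (p - 1)\<close> of the flux is exactly what turns \<open>p\<close>-integrability into
  integrability of the power \<open>p / (p - 1)\<close>.
\<close>

lemma lap_in_dual:
  assumes "u \<in> Lp_fun M p"
  shows "lap u \<in> Lp_fun M (p / (p - 1))"
proof -
  note [measurable] = assms(1)[THEN Lp_fun_measurable]
  let ?r = "p - 1" and ?q = "p / (p - 1)"
  have r: "1 \<le> ?r" "0 \<le> ?r" "0 \<le> ?q" "?r * ?q = p" using p_ge by auto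
  have int: "integrable M (\<lambda>y. \<bar>u y\<bar> powr ?r)"
    using Lp_fun_mono[OF assms, of ?r] p_ge by (auto simp: Lp_fun_def)
  define I where "I = (LINT y|M. \<bar>u y\<bar> powr ?r)"
  define c where "c = C * 2 powr ?r"
  have bd: "\<bar>lap u x\<bar> \<le> \<bar>c * I + c * measure M (space M) * \<bar>u x\<bar> powr ?r\<bar>" if x: "x \<in> space M" for x
  proof -
    have "\<bar>lap u x\<bar> \<le> (LINT y|M. \<bar>k x y * pflux p (u y - u x)\<bar>)"
      unfolding lap_def abs_minus_cancel by (rule integral_abs_bound)
    also have "\<dots> \<le> (LINT y|M. C * (2 powr ?r * (\<bar>u y\<bar> powr ?r + \<bar>u x\<bar> powr ?r)))"
    proof (rule integral_mono)
      show "integrable M (\<lambda>y. \<bar>k x y * pflux p (u y - u x)\<bar>)"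
        using flux_integrable[OF assms x] by (rule integrable_abs)
      show "integrable M (\<lambda>y. C * (2 powr ?r * (\<bar>u y\<bar> powr ?r + \<bar>u x\<bar> powr ?r)))"
        using int by simp
      show "\<bar>k x y * pflux p (u y - u x)\<bar> \<le> C * (2 powr ?r * (\<bar>u y\<bar> powr ?r + \<bar>u x\<bar> powr ?r))" for y
        unfolding abs_mult abs_pflux
        using powr_add_le[of ?r "u y" "- u x"] r k_nonneg k_le C_nonneg
        by (intro mult_mono) auto
    qed
    also have "\<dots> = c * I + c * measure M (space M) * \<bar>u x\<bar> powr ?r"
      using int by (simp add: c_def I_def algebra_simps)
    finally show ?thesis by linarith
  qed
  have "(\<lambda>x. c * measure M (space M) * \<bar>u x\<bar> powr ?r) \<in> Lp_fun M ?q"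
  proof (rule Lp_fun_scale)
    show "(\<lambda>x. \<bar>u x\<bar> powr ?r) \<in> Lp_fun M ?q"
      using assms r by (simp add: Lp_fun_def powr_powr)
  qed
  moreover have "(\<lambda>x. c * I) \<in> Lp_fun M ?q"
    using r by (intro Lp_fun_bounded[of _ "\<bar>c * I\<bar>"]) auto
  ultimately have "(\<lambda>x. c * I + c * measure M (space M) * \<bar>u x\<bar> powr ?r) \<in> Lp_fun M ?q"
    using r by (intro Lp_fun_add) auto
  then show ?thesis
    by (rule Lp_fun_dominated) (use bd r in \<open>auto\<close>)
qed

lemma lap_integrable: "u \<in> Lp_fun M p \<Longrightarrow> integrable M (lap u)"
  by (rule Lp_fun_integrable[OF lap_in_dual]) (use p_ge in auto)

lemma oper_integrable: "u \<in> Lp_fun M p \<Longrightarrow> integrable M (oper u)"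
  unfolding oper_def[abs_def]
  by (intro Bochner_Integration.integrable_add integrable_mult_right lap_integrable m_integrable)

lemma integrable_fst_product:
  assumes "integrable M f"
  shows "integrable (M \<Otimes>\<^sub>M M) (\<lambda>(x, y). f x :: real)"
proof (rule pair.Fubini_integrable)
  note [measurable] = borel_measurable_integrable[OF assms]
  show "(\<lambda>(x, y). f x) \<in> borel_measurable (M \<Otimes>\<^sub>M M)" by measurable
  show "integrable M (\<lambda>x. \<integral>y. norm (case (x, y) of (x, y) \<Rightarrow> f x) \<partial>M)"
    using assms by simp
qed simp

lemma integrable_snd_product:
  assumes "integrable M f"
  shows "integrable (M \<Otimes>\<^sub>M M) (\<lambda>(x, y). f y :: real)"
  using pair.integrable_product_swap[OF integrable_fst_product[OF assms]]
  by (simp add: case_prod_beta)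

lemma weighted_flux_integrable:
  assumes u: "u \<in> Lp_fun M p" and g [measurable]: "g \<in> borel_measurable M" and "\<And>x. \<bar>g x\<bar> \<le> L"
  shows "integrable (M \<Otimes>\<^sub>M M) (\<lambda>(x, y). k x y * pflux p (u y - u x) * g x)"
proof -
  note [measurable] = u[THEN Lp_fun_measurable]
  let ?b = "\<lambda>(x, y). C * (2 powr (p - 1) * (2 + \<bar>u y\<bar> powr p + \<bar>u x\<bar> powr p)) * L"
  have "integrable (M \<Otimes>\<^sub>M M) (\<lambda>z. C * (2 powr (p - 1) *
    (2 + (case z of (x, y) \<Rightarrow> \<bar>u y\<bar> powr p) + (case z of (x, y) \<Rightarrow> \<bar>u x\<bar> powr p))) * L)"
  proof -
    interpret P: finite_measure "M \<Otimes>\<^sub>M M"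
      by (rule finite_measure_pair_measure) unfold_locales
    show ?thesis
      using Lp_fun_powr_integrable[OF u]
      by (intro integrable_mult_right integrable_mult_left Bochner_Integration.integrable_add P.integrable_const
        integrable_fst_product integrable_snd_product)
  qed
  then have "integrable (M \<Otimes>\<^sub>M M) ?b"
    by (rule back_subst[where P = "integrable (M \<Otimes>\<^sub>M M)"]) (simp add: fun_eq_iff)
  then show ?thesis
  proof (rule Bochner_Integration.integrable_bound)
    have "\<bar>k x y * pflux p (u y - u x) * g x\<bar> \<le> ?b (x, y)" for x y
      unfolding abs_mult prod.case using k_nonneg k_le p_ge C_nonneg assms(3)
      by (intro mult_mono abs_pflux_diff_le) auto
    then show "AE z in M \<Otimes>\<^sub>M M. norm (case z of (x, y) \<Rightarrow> k x y * pflux p (u y - u x) * g x)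
        \<le> norm (?b z)"
      by (auto intro!: AE_I2 order_trans[OF _ abs_ge_self])
  qed measurable
qed

lemma integral_weighted_lap:
  assumes u: "u \<in> Lp_fun M p" and g [measurable]: "g \<in> borel_measurable M" and "\<And>x. \<bar>g x\<bar> \<le> L"
  shows "(LINT x|M. g x * lap u x) = - (LINT z|(M \<Otimes>\<^sub>M M). (\<lambda>(x, y). k x y * pflux p (u y - u x) * g x) z)"
  by (subst pair.integral_fst'[OF weighted_flux_integrable[OF assms], symmetric])
     (simp add: lap_def mult.commute)

section \<open>Complete accretivity\<close>

text \<open>
  Monotonicity of the nonlocal operator, tested with \<open>g (u - v)\<close>. Exchanging \<open>x\<close> and \<open>y\<close>
  reverses the sign of the flux, so twice the pairing is the double integral of
  \<open>k(x, y)\<close> times the product of the flux difference and \<open>G y - G x\<close>. Both factors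
  have the sign of the increment of \<open>u - v\<close> from \<open>x\<close> to \<open>y\<close>.
\<close>

lemma lap_pairing_nonneg:
  assumes u: "u \<in> Lp_fun M p" and v: "v \<in> Lp_fun M p" and g: "mono g" "\<And>s. \<bar>g s\<bar> \<le> L"
  shows "0 \<le> (LINT x|M. g (u x - v x) * (lap u x - lap v x))"
proof -
  note [measurable] = u[THEN Lp_fun_measurable] v[THEN Lp_fun_measurable] borel_measurable_mono[OF g(1)]
  define G where "G x = g (u x - v x)" for x
  have G [measurable]: "G \<in> borel_measurable M" unfolding G_def by measurable
  have GL: "\<bar>G x\<bar> \<le> L" for x using g by (simp add: G_def)
  define F where "F = (\<lambda>(x, y). k x y * (pflux p (u y - u x) - pflux p (v y - v x)) * G x)"
  let ?U = "\<lambda>(x, y). k x y * pflux p (u y - u x) * G x"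
  let ?V = "\<lambda>(x, y). k x y * pflux p (v y - v x) * G x"
  note U = weighted_flux_integrable[OF u G GL] and V = weighted_flux_integrable[OF v G GL]
  have F_eq: "F = (\<lambda>z. ?U z - ?V z)" by (auto simp: F_def algebra_simps fun_eq_iff)
  have F: "integrable (M \<Otimes>\<^sub>M M) F" unfolding F_eq using U V by (rule Bochner_Integration.integrable_diff)
  have bd_int: "integrable M (\<lambda>x. G x * lap w x)" if "w \<in> Lp_fun M p" for w
  proof (rule Bochner_Integration.integrable_bound[of M "\<lambda>x. L * lap w x"])
    show "integrable M (\<lambda>x. L * lap w x)" using lap_integrable[OF that] by simp
    show "(\<lambda>x. G x * lap w x) \<in> borel_measurable M"
      using that[THEN Lp_fun_measurable] by measurable
    show "AE x in M. norm (G x * lap w x) \<le> norm (L * lap w x)"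
      using order_trans[OF GL abs_ge_self] by (auto simp: abs_mult mult_right_mono)
  qed
  have "(LINT x|M. G x * (lap u x - lap v x)) = (LINT x|M. G x * lap u x) - (LINT x|M. G x * lap v x)"
    using bd_int u v by (simp add: right_diff_distrib)
  also have "\<dots> = - (LINT z|(M \<Otimes>\<^sub>M M). F z)"
    unfolding integral_weighted_lap[OF u G GL] integral_weighted_lap[OF v G GL] F_eq
      Bochner_Integration.integral_diff[OF U V] by linarith
  also have "2 * \<dots> = - ((LINT z|(M \<Otimes>\<^sub>M M). F z) + (LINT z|(M \<Otimes>\<^sub>M M). (case z of (x, y) \<Rightarrow> F (y, x))))"
    using pair.integral_product_swap[of F] F by (simp add: borel_measurable_integrable)
  also have "\<dots> = - (LINT z|(M \<Otimes>\<^sub>M M). F z + (case z of (x, y) \<Rightarrow> F (y, x)))"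
    using F pair.integrable_product_swap[OF F] by (simp add: Bochner_Integration.integral_add)
  also have "\<dots> \<ge> 0"
  proof -
    have "F (x, y) + F (y, x) \<le> 0" for x y
    proof -
      let ?D = "pflux p (u y - u x) - pflux p (v y - v x)"
      have "pflux p (u x - u y) = - pflux p (u y - u x)" "pflux p (v x - v y) = - pflux p (v y - v x)"
        using pflux_minus[of p "u y - u x"] pflux_minus[of p "v y - v x"] by simp_all
      then have "F (x, y) + F (y, x) = k x y * (?D * (G x - G y))"
        by (simp add: F_def k_sym[of y x] algebra_simps)
      moreover have "?D * (G x - G y) \<le> 0"
      proof (cases "u x - v x \<le> u y - v y")
        case True
        then have "0 \<le> ?D" using pflux_mono[of p "v y - v x" "u y - u x"] p_ge by simp
        moreover have "G x \<le> G y" unfolding G_def using True by (rule monoD[OF g(1)])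
        ultimately show ?thesis by (simp add: mult_nonneg_nonpos)
      next
        case False
        then have "?D \<le> 0" using pflux_mono[of p "u y - u x" "v y - v x"] p_ge by simp
        moreover have "G y \<le> G x" unfolding G_def using False by (intro monoD[OF g(1)]) linarith
        ultimately show ?thesis by (simp add: mult_nonpos_nonneg)
      qed
      ultimately show ?thesis using k_nonneg[of x y] by (simp add: mult_nonneg_nonpos)
    qed
    then have "(LINT z|(M \<Otimes>\<^sub>M M). F z + (case z of (x, y) \<Rightarrow> F (y, x))) \<le> (LINT z|(M \<Otimes>\<^sub>M M). 0)"
      using F pair.integrable_product_swap[OF F] by (intro integral_mono) auto
    then show ?thesis by simp
  qed
  finally show ?thesis by (simp add: G_def)
qed

text \<open>
  For a Lipschitz \<open>j\<close> this is the subgradient inequality integrated, all terms being integrable.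
  The Lipschitz regularizations increase to \<open>j\<close>, hence the general case by monotone convergence.
\<close>

theorem oper_contraction:
  assumes u: "u \<in> Lp_fun M p" and v: "v \<in> Lp_fun M p" and l: "0 < l" and j: "j \<in> convex_lsc_class"
  shows "(\<integral>\<^sup>+ x. j (u x - v x) \<partial>M) \<le> (\<integral>\<^sup>+ x. j (u x - v x + l * (oper u x - oper v x)) \<partial>M)"
proof -
  note [measurable] = u[THEN Lp_fun_measurable] v[THEN Lp_fun_measurable]
  define a where "a x = u x - v x" for x
  define b where "b x = oper u x - oper v x" for x
  have a: "integrable M a" unfolding a_def
    using u v p_ge by (intro Bochner_Integration.integrable_diff Lp_fun_integrable[of _ p]) auto
  have b: "integrable M b" unfolding b_def
    using u v by (intro Bochner_Integration.integrable_diff oper_integrable)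
  note [measurable] = borel_measurable_integrable[OF a] borel_measurable_integrable[OF b]
  let ?J = "lipschitz_regularization j"
  have main: "(\<integral>\<^sup>+ x. ?J n (a x) \<partial>M) \<le> (\<integral>\<^sup>+ x. ?J n (a x + l * b x) \<partial>M)"
    and meas: "?J n \<in> borel_measurable borel" for n
  proof -
    obtain h where h: "\<And>x. ?J n x = ennreal (h x)" "\<And>x. 0 \<le> h x" "h 0 = 0"
      "\<And>x y. h x \<le> h y + real n * \<bar>x - y\<bar>" "convex_on UNIV h"
      using regularization_real[OF j] by blast
    obtain g where g: "\<And>x y. h x + g x * (y - x) \<le> h y" "mono g" "\<And>x. \<bar>g x\<bar> \<le> real n"
      using convex_subgradient[OF h(5,4)] by blast
    have "continuous_on UNIV h" using h(5) by (intro convex_on_continuous) auto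
    then have hm [measurable]: "h \<in> borel_measurable borel" by (rule borel_measurable_continuous_onI)
    have gm [measurable]: "g \<in> borel_measurable borel" using g(2) by (rule borel_measurable_mono)
    show "?J n \<in> borel_measurable borel" unfolding h(1)[abs_def] by measurable
    have hint: "integrable M (\<lambda>x. h (w x))" if w: "integrable M w" for w
    proof (rule Bochner_Integration.integrable_bound[of M "\<lambda>x. real n * w x"])
      note [measurable] = borel_measurable_integrable[OF w]
      show "integrable M (\<lambda>x. real n * w x)" using w by simp
      show "(\<lambda>x. h (w x)) \<in> borel_measurable M" by measurable
      show "AE x in M. norm (h (w x)) \<le> norm (real n * w x)"
        using h(2) h(4)[of _ 0] h(3) by (auto simp: abs_mult)
    qed
    have gint: "integrable M (\<lambda>x. g (a x) * w x)" if w: "integrable M w" for w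
    proof (rule Bochner_Integration.integrable_bound[of M "\<lambda>x. real n * w x"])
      note [measurable] = borel_measurable_integrable[OF w]
      show "integrable M (\<lambda>x. real n * w x)" using w by simp
      show "(\<lambda>x. g (a x) * w x) \<in> borel_measurable M" by measurable
      show "AE x in M. norm (g (a x) * w x) \<le> norm (real n * w x)"
        using g(3) by (auto intro!: AE_I2 mult_right_mono simp: abs_mult)
    qed
    have ma: "integrable M (\<lambda>x. m x * a x)"
      unfolding a_def using u v p_ge by (intro m_integrable Lp_fun_diff) auto
    have laps: "integrable M (\<lambda>x. lap u x - lap v x)"
      using u v by (intro Bochner_Integration.integrable_diff lap_integrable)
    have "0 \<le> (LINT x|M. \<mu> * (g (a x) * (lap u x - lap v x)))"
      using lap_pairing_nonneg[OF u v g(2,3)] mu_pos by (simp add: a_def)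
    moreover have "0 \<le> (LINT x|M. g (a x) * (m x * a x))"
    proof (rule integral_nonneg_AE, rule AE_I2)
      fix x
      have "0 \<le> g (a x) * a x" using g(1)[of "a x" 0] h(2)[of "a x"] h(3) by simp
      then show "0 \<le> g (a x) * (m x * a x)" using m_nonneg[of x]
        by (metis mult.left_commute mult_nonneg_nonneg)
    qed
    moreover have "(LINT x|M. g (a x) * b x) = (LINT x|M. \<mu> * (g (a x) * (lap u x - lap v x)) + g (a x) * (m x * a x))"
      by (intro Bochner_Integration.integral_cong refl) (simp add: a_def b_def oper_def algebra_simps)
    ultimately have gb: "0 \<le> (LINT x|M. g (a x) * b x)"
      using gint[OF laps] gint[OF ma] by simp
    have "(LINT x|M. h (a x)) \<le> (LINT x|M. h (a x) + l * (g (a x) * b x))"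
      using gb gint[OF b] hint[OF a] l by simp
    also have "\<dots> \<le> (LINT x|M. h (a x + l * b x))"
    proof (rule integral_mono)
      show "integrable M (\<lambda>x. h (a x) + l * (g (a x) * b x))" using gint[OF b] hint[OF a] by simp
      show "integrable M (\<lambda>x. h (a x + l * b x))" using a b by (intro hint) simp
      show "h (a x) + l * (g (a x) * b x) \<le> h (a x + l * b x)" for x
        using g(1)[of "a x" "a x + l * b x"] by (simp add: algebra_simps)
    qed
    finally have "(LINT x|M. h (a x)) \<le> (LINT x|M. h (a x + l * b x))" .
    moreover have "integrable M (\<lambda>x. h (a x + l * b x))" using a b by (intro hint) simp
    ultimately show "(\<integral>\<^sup>+ x. ?J n (a x) \<partial>M) \<le> (\<integral>\<^sup>+ x. ?J n (a x + l * b x) \<partial>M)"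
      unfolding h(1) using hint[OF a] h(2) by (simp add: nn_integral_eq_integral ennreal_leI)
  qed
  note [measurable] = meas
  have "(\<integral>\<^sup>+ x. j (a x) \<partial>M) = (\<integral>\<^sup>+ x. (SUP n. ?J n (a x)) \<partial>M)"
    by (simp add: SUP_regularization[OF j])
  also have "\<dots> = (SUP n. \<integral>\<^sup>+ x. ?J n (a x) \<partial>M)"
    using incseq_regularization
    by (intro nn_integral_monotone_convergence_SUP) (auto simp: incseq_def le_fun_def)
  also have "\<dots> \<le> (\<integral>\<^sup>+ x. j (a x + l * b x) \<partial>M)"
  proof (rule SUP_least)
    fix n
    have "(\<integral>\<^sup>+ x. ?J n (a x) \<partial>M) \<le> (\<integral>\<^sup>+ x. ?J n (a x + l * b x) \<partial>M)" by (rule main)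
    also have "\<dots> \<le> (\<integral>\<^sup>+ x. j (a x + l * b x) \<partial>M)" by (intro nn_integral_mono regularization_le)
    finally show "(\<integral>\<^sup>+ x. ?J n (a x) \<partial>M) \<le> (\<integral>\<^sup>+ x. j (a x + l * b x) \<partial>M)" .
  qed
  finally show ?thesis by (simp add: a_def b_def)
qed


section \<open>The range condition\<close>

lemma lap_const [simp]: "lap (\<lambda>_. c) x = 0"
  by (simp add: lap_def)

lemma oper_zero [simp]: "oper (\<lambda>_. 0) x = 0"
  by (simp add: oper_def)

lemma lap_minus: "lap (\<lambda>x. - u x) x = - lap u x"
proof -
  have "pflux p (- u y - - u x) = - pflux p (u y - u x)" for y
    using pflux_minus[of p "u y - u x"] by simp
  then show ?thesis by (simp add: lap_def)
qed

lemma oper_minus: "oper (\<lambda>x. - u x) x = - oper u x"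
  by (simp add: oper_def lap_minus)

text \<open>
  Continuity of the nonlocal operator under dominated almost everywhere convergence. It serves
  both the iteration for bounded data and the passage to unbounded data.
\<close>

lemma lap_tendsto:
  assumes w: "\<And>n. w n \<in> borel_measurable M" and u: "u \<in> borel_measurable M"
    and U: "U \<in> Lp_fun M p" and bd: "AE x in M. \<forall>n. \<bar>w n x\<bar> \<le> U x"
    and lim: "AE x in M. (\<lambda>n. w n x) \<longlonglongrightarrow> u x"
  shows "AE x in M. (\<lambda>n. lap (w n) x) \<longlonglongrightarrow> lap u x"
proof -
  note [measurable] = w u U[THEN Lp_fun_measurable]
  show ?thesis
    using bd lim AE_space
  proof eventually_elim
    case (elim x)
    then have x [simp, measurable]: "x \<in> space M" by simp
    have "(\<lambda>n. LINT y|M. k x y * pflux p (w n y - w n x)) \<longlonglongrightarrow> (LINT y|M. k x y * pflux p (u y - u x))"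
    proof (rule integral_dominated_convergence)
      show "integrable M (\<lambda>y. C * (2 powr (p - 1) * (2 + \<bar>U y\<bar> powr p + \<bar>U x\<bar> powr p)))"
        using U by (intro integrable_mult_right Bochner_Integration.integrable_add integrable_const
            Lp_fun_powr_integrable)
      show "AE y in M. (\<lambda>n. k x y * pflux p (w n y - w n x)) \<longlonglongrightarrow> k x y * pflux p (u y - u x)"
        using lim
      proof eventually_elim
        case (elim y)
        have "isCont (pflux p) (u y - u x)"
          using continuous_pflux[of p] p_ge by (auto simp: continuous_on_eq_continuous_at)
        then have "(\<lambda>n. pflux p (w n y - w n x)) \<longlonglongrightarrow> pflux p (u y - u x)"
          by (rule isCont_tendsto_compose) (intro tendsto_diff elim \<open>(\<lambda>n. w n x) \<longlonglongrightarrow> u x\<close>)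
        then show ?case by (rule tendsto_mult_left)
      qed
      show "AE y in M. norm (k x y * pflux p (w n y - w n x))
          \<le> C * (2 powr (p - 1) * (2 + \<bar>U y\<bar> powr p + \<bar>U x\<bar> powr p))" for n
        using bd
      proof eventually_elim
        case (elim y)
        have "\<bar>w n y\<bar> \<le> \<bar>U y\<bar>" "\<bar>w n x\<bar> \<le> \<bar>U x\<bar>"
          using elim \<open>\<forall>n. \<bar>w n x\<bar> \<le> U x\<close> order_trans[OF _ abs_ge_self] by blast+
        then have le: "\<bar>w n y\<bar> powr p \<le> \<bar>U y\<bar> powr p" "\<bar>w n x\<bar> powr p \<le> \<bar>U x\<bar> powr p"
          using p_ge by (auto intro!: powr_mono2)
        have "\<bar>pflux p (w n y - w n x)\<bar> \<le> 2 powr (p - 1) * (2 + \<bar>w n y\<bar> powr p + \<bar>w n x\<bar> powr p)"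
          using p_ge by (intro abs_pflux_diff_le) auto
        also have "\<dots> \<le> 2 powr (p - 1) * (2 + \<bar>U y\<bar> powr p + \<bar>U x\<bar> powr p)"
          using le by (intro mult_left_mono add_mono) auto
        finally show ?case
          using k_nonneg k_le C_nonneg by (auto simp: abs_mult intro!: mult_mono)
      qed
    qed measurable
    then show ?case unfolding lap_def by (rule tendsto_minus)
  qed
qed

definition solves :: "real \<Rightarrow> ('a \<Rightarrow> real) \<Rightarrow> ('a \<Rightarrow> real) \<Rightarrow> bool" where
  "solves l H u \<longleftrightarrow> u \<in> Lp_fun M p \<and> (AE x in M. u x + l * oper u x = H x)"

text \<open>
  Raising \<open>v\<close> to \<open>w\<close> increases the values at \<open>y\<close>, which helps by monotonicity of the flux, and
  the value at \<open>x\<close>, which costs at most the Lipschitz constant of the flux on \<open>[-2 N, 2 N]\<close>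
  times \<open>w x - v x\<close>, integrated against the kernel. The shift \<open>L\<close> pays for this cost.
\<close>

lemma shifted_lap_mono:
  assumes [measurable]: "v \<in> borel_measurable M" "w \<in> borel_measurable M" and x: "x \<in> space M"
    and v: "\<And>y. y \<in> space M \<Longrightarrow> \<bar>v y\<bar> \<le> N" and w: "\<And>y. y \<in> space M \<Longrightarrow> \<bar>w y\<bar> \<le> N"
    and vw: "\<And>y. y \<in> space M \<Longrightarrow> v y \<le> w y"
    and L: "L = C * ((p - 1) * (2 * N) powr (p - 2)) * measure M (space M)"
  shows "L * v x - lap v x \<le> L * w x - lap w x"
proof -
  define D where "D = (p - 1) * (2 * N) powr (p - 2) * (w x - v x)"
  have D: "0 \<le> D" using vw[OF x] p_ge by (simp add: D_def)
  have vp: "v \<in> Lp_fun M p" and wp: "w \<in> Lp_fun M p"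
    using v w p_ge by (auto intro!: Lp_fun_bounded[of _ N])
  have "(LINT y|M. k x y * pflux p (v y - v x)) \<le> (LINT y|M. k x y * pflux p (w y - w x) + C * D)"
  proof (rule integral_mono)
    fix y assume y: "y \<in> space M"
    have "pflux p (v y - v x) - pflux p (v y - w x)
        \<le> (p - 1) * (2 * N) powr (p - 2) * ((v y - v x) - (v y - w x))"
      using v[OF x] v[OF y] w[OF x] vw[OF x] p_ge by (intro pflux_lipschitz) auto
    moreover have "pflux p (v y - w x) \<le> pflux p (w y - w x)"
      using vw[OF y] p_ge by (intro pflux_mono) auto
    ultimately have "pflux p (v y - v x) \<le> pflux p (w y - w x) + D" by (simp add: D_def)
    then have "k x y * pflux p (v y - v x) \<le> k x y * (pflux p (w y - w x) + D)"
      using k_nonneg by (intro mult_left_mono) auto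
    also have "\<dots> \<le> k x y * pflux p (w y - w x) + C * D"
      using mult_right_mono[OF k_le D, of x y] by (simp add: distrib_left)
    finally show "k x y * pflux p (v y - v x) \<le> k x y * pflux p (w y - w x) + C * D" .
  qed (use flux_integrable[OF vp x] flux_integrable[OF wp x] in auto)
  also have "\<dots> = (LINT y|M. k x y * pflux p (w y - w x)) + C * D * measure M (space M)"
    using flux_integrable[OF wp x] by simp
  finally have "- lap v x \<le> - lap w x + C * D * measure M (space M)" by (simp add: lap_def)
  also have "C * D * measure M (space M) = L * (w x - v x)" by (simp add: L D_def)
  finally show ?thesis by (simp add: algebra_simps)
qed

text \<open>
  Monotone iteration between the constants \<open>- N\<close> and \<open>N\<close>, which are sub- and supersolution because
  the nonlocal operator annihilates constants. The shift by \<open>L\<close> makes the iteration map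
  order-preserving; dividing by \<open>d\<close> treats multiplication by \<open>m\<close> implicitly, so an
  unbounded \<open>m\<close> does no harm.
\<close>

lemma solvable_bounded:
  assumes H [measurable]: "H \<in> borel_measurable M" and HN: "\<And>x. \<bar>H x\<bar> \<le> N" and l: "0 < l"
  shows "\<exists>u. solves l H u"
proof -
  have N: "0 \<le> N" using HN[of undefined] by linarith
  define L where "L = C * ((p - 1) * (2 * N) powr (p - 2)) * measure M (space M)"
  have L: "0 \<le> L" using C_nonneg p_ge by (simp add: L_def)
  (* The coefficient of the unknown after adding l * mu * L times it to both sides. *)
  define d where "d x = 1 + l * m x + l * \<mu> * L" for x
  have d: "0 < d x" for x
    unfolding d_def using l m_nonneg mu_pos L by (intro add_pos_nonneg) auto
  define T where "T w x = (H x + l * \<mu> * (L * w x - lap w x)) / d x" for w x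
  have T_measurable [measurable]: "T w \<in> borel_measurable M" if [measurable]: "w \<in> borel_measurable M" for w
    unfolding T_def d_def by measurable
  have T_mono: "T v x \<le> T w x"
    if "v \<in> borel_measurable M" "w \<in> borel_measurable M" "x \<in> space M"
      "\<And>y. y \<in> space M \<Longrightarrow> \<bar>v y\<bar> \<le> N" "\<And>y. y \<in> space M \<Longrightarrow> \<bar>w y\<bar> \<le> N"
      "\<And>y. y \<in> space M \<Longrightarrow> v y \<le> w y" for v w x
    unfolding T_def using shifted_lap_mono[OF that L_def] l mu_pos d[of x]
    by (intro divide_right_mono add_left_mono mult_left_mono) auto
  have T_lower: "- N \<le> T (\<lambda>_. - N) x" and T_upper: "T (\<lambda>_. N) x \<le> N" for x
  proof -
    have "0 \<le> l * m x * N" using l m_nonneg[of x] N by simp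
    then show "- N \<le> T (\<lambda>_. - N) x" "T (\<lambda>_. N) x \<le> N"
      unfolding T_def using d[of x] HN[of x]
      by (auto simp: pos_le_divide_eq pos_divide_le_eq d_def algebra_simps)
  qed
  define W where "W n = (T ^^ n) (\<lambda>_. - N)" for n
  have W_Suc: "W (Suc n) = T (W n)" for n by (simp add: W_def)
  have W_measurable [measurable]: "W n \<in> borel_measurable M" for n
    by (induction n) (simp_all add: W_def T_measurable)
  have W: "- N \<le> W n x \<and> W n x \<le> W (Suc n) x \<and> W (Suc n) x \<le> N" if "x \<in> space M" for n x
    using that
  proof (induction n arbitrary: x)
    case 0
    have "T (\<lambda>_. - N) x \<le> T (\<lambda>_. N) x" using N 0 by (intro T_mono) auto
    then show ?case using T_lower[of x] T_upper[of x] by (simp add: W_def)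
  next
    case (Suc n)
    have bd: "\<bar>W n y\<bar> \<le> N" "\<bar>W (Suc n) y\<bar> \<le> N" if "y \<in> space M" for y
      using Suc.IH[OF that] by auto
    have "T (W n) x \<le> T (W (Suc n)) x"
      using Suc bd by (intro T_mono) auto
    moreover have "T (W (Suc n)) x \<le> T (\<lambda>_. N) x"
      using Suc bd N by (intro T_mono) auto
    ultimately show ?case
      using Suc.IH[OF Suc.prems] T_upper[of x] by (simp add: W_Suc)
  qed
  define u where "u x = lim (\<lambda>n. W n x)" for x
  have u_measurable [measurable]: "u \<in> borel_measurable M"
    unfolding u_def by measurable
  have lim: "(\<lambda>n. W n x) \<longlonglongrightarrow> u x" if "x \<in> space M" for x
  proof -
    have "incseq (\<lambda>n. W n x)" using W[OF that] by (intro incseq_SucI) auto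
    moreover have "W n x \<le> N" for n using W[OF that, of n] by linarith
    ultimately have "convergent (\<lambda>n. W n x)" by (metis incseq_convergent convergentI)
    then show ?thesis unfolding u_def by (rule convergent_LIMSEQ_iff[THEN iffD1])
  qed
  have Wbd: "\<bar>W n x\<bar> \<le> N" if "x \<in> space M" for n x using W[OF that, of n] by auto
  have "\<bar>u x\<bar> \<le> N" if "x \<in> space M" for x
    using tendsto_rabs[OF lim[OF that]] Wbd[OF that] by (intro LIMSEQ_le_const2) auto
  then have up: "u \<in> Lp_fun M p" using p_ge by (intro Lp_fun_bounded[of _ N]) auto
  have "AE x in M. (\<lambda>n. lap (W n) x) \<longlonglongrightarrow> lap u x"
  proof (rule lap_tendsto[where U = "\<lambda>_. N"])
    show "(\<lambda>_. N) \<in> Lp_fun M p" using p_ge by (intro Lp_fun_bounded[of _ "\<bar>N\<bar>"]) auto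
  qed (use Wbd lim in auto)
  then have "AE x in M. u x + l * oper u x = H x"
    using AE_space
  proof eventually_elim
    case (elim x)
    have "(\<lambda>n. W (Suc n) x) \<longlonglongrightarrow> T u x"
      unfolding W_Suc T_def using d[of x] elim lim by (intro tendsto_intros) auto
    moreover have "(\<lambda>n. W (Suc n) x) \<longlonglongrightarrow> u x" using lim elim by (intro LIMSEQ_Suc) auto
    ultimately have "u x = T u x" by (rule LIMSEQ_unique[symmetric])
    then have "u x * d x = H x + l * \<mu> * (L * u x - lap u x)"
      unfolding T_def using d[of x] by (simp add: field_simps)
    then show ?case by (simp add: d_def oper_def algebra_simps)
  qed
  then show ?thesis using up by (auto simp: solves_def)
qed

lemma solves_contraction:
  assumes u: "solves l F u" and v: "solves l G v" and l: "0 < l" and j: "j \<in> convex_lsc_class"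
  shows "(\<integral>\<^sup>+ x. j (u x - v x) \<partial>M) \<le> (\<integral>\<^sup>+ x. j (F x - G x) \<partial>M)"
proof -
  have "(\<integral>\<^sup>+ x. j (u x - v x) \<partial>M) \<le> (\<integral>\<^sup>+ x. j (u x - v x + l * (oper u x - oper v x)) \<partial>M)"
    using assms by (intro oper_contraction) (auto simp: solves_def)
  also have "\<dots> = (\<integral>\<^sup>+ x. j (F x - G x) \<partial>M)"
  proof (rule nn_integral_cong_AE)
    have "AE x in M. u x + l * oper u x = F x" "AE x in M. v x + l * oper v x = G x"
      using u v by (auto simp: solves_def)
    then show "AE x in M. j (u x - v x + l * (oper u x - oper v x)) = j (F x - G x)"
    proof eventually_elim
      case (elim x)
      have "u x - v x + l * (oper u x - oper v x) = F x - G x"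
        unfolding elim[symmetric] by (simp add: algebra_simps)
      then show ?case by simp
    qed
  qed
  finally show ?thesis .
qed

text \<open>
  Comparison principle: the contraction estimate for the positive part, whose integral vanishes on
  the side of the data.
\<close>

lemma solves_mono:
  assumes u: "solves l F u" and v: "solves l G v" and l: "0 < l" and FG: "AE x in M. F x \<le> G x"
  shows "AE x in M. u x \<le> v x"
proof -
  have [measurable]: "u \<in> borel_measurable M" "v \<in> borel_measurable M"
    using u v by (auto simp: solves_def Lp_fun_def)
  have "(\<integral>\<^sup>+ x. ennreal (max 0 (u x - v x)) \<partial>M) \<le> (\<integral>\<^sup>+ x. ennreal (max 0 (F x - G x)) \<partial>M)"
    by (rule solves_contraction[OF u v l]) (intro ennreal_convex_lsc convex_on_max_0, auto)
  also have "\<dots> = (\<integral>\<^sup>+ x. 0 \<partial>M)"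
    using FG by (intro nn_integral_cong_AE) auto
  finally have "(\<integral>\<^sup>+ x. ennreal (max 0 (u x - v x)) \<partial>M) = 0" by simp
  then have "AE x in M. ennreal (max 0 (u x - v x)) = 0" by (subst (asm) nn_integral_0_iff_AE) auto
  then show ?thesis by eventually_elim (auto simp: max_def split: if_splits)
qed

text \<open>
  The contraction estimate against the trivial solution, for \<open>j t = \<bar>t\<bar>\<^sup>p\<close>.
\<close>

lemma solves_norm_le:
  assumes u: "solves l F u" and l: "0 < l"
  shows "(\<integral>\<^sup>+ x. ennreal (\<bar>u x\<bar> powr p) \<partial>M) \<le> (\<integral>\<^sup>+ x. ennreal (\<bar>F x\<bar> powr p) \<partial>M)"
proof -
  have "solves l (\<lambda>_. 0) (\<lambda>_. 0)"
    using p_ge by (auto simp: solves_def Lp_fun_def)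
  then have "(\<integral>\<^sup>+ x. ennreal (\<bar>u x - 0\<bar> powr p) \<partial>M) \<le> (\<integral>\<^sup>+ x. ennreal (\<bar>F x - 0\<bar> powr p) \<partial>M)"
    by (rule solves_contraction[OF u _ l]) (use p_ge in \<open>intro ennreal_convex_lsc convex_on_abs_powr, auto\<close>)
  then show ?thesis by simp
qed

text \<open>
  The solutions increase by comparison, and their bounded \<open>L\<^sup>p\<close> norms keep the limit finite
  almost everywhere and in \<open>L\<^sup>p\<close> by Fatou. The first solution and the limit together dominate
  the sequence, so the equation passes to the limit.
\<close>

lemma solvable_incseq_limit:
  assumes H: "H \<in> Lp_fun M p" and l: "0 < l"
    and sol: "\<And>n. \<exists>u. solves l (F n) u"
    and mono: "\<And>n. AE x in M. F n x \<le> F (Suc n) x"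
    and bd: "\<And>n. AE x in M. \<bar>F n x\<bar> \<le> \<bar>H x\<bar>"
    and lim: "AE x in M. (\<lambda>n. F n x) \<longlonglongrightarrow> H x"
  shows "\<exists>u. solves l H u"
proof -
  obtain w where w: "\<And>n. solves l (F n) (w n)" using sol by metis
  have wp: "w n \<in> Lp_fun M p" for n using w by (simp add: solves_def)
  then have [measurable]: "w n \<in> borel_measurable M" for n by (rule Lp_fun_measurable)
  have "AE x in M. \<forall>n. w n x \<le> w (Suc n) x"
    using solves_mono[OF w w l mono] by (simp add: AE_all_countable)
  then have inc: "AE x in M. incseq (\<lambda>n. w n x)"
    by eventually_elim (auto intro: incseq_SucI)
  define B where "B = (\<integral>\<^sup>+ x. ennreal (\<bar>H x\<bar> powr p) \<partial>M)"
  have B: "B < \<infinity>" unfolding B_def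
    using H by (auto simp: Lp_fun_def integrable_iff_bounded)
  have wB: "(\<integral>\<^sup>+ x. ennreal (\<bar>w n x\<bar> powr p) \<partial>M) \<le> B" for n
  proof -
    have "(\<integral>\<^sup>+ x. ennreal (\<bar>w n x\<bar> powr p) \<partial>M) \<le> (\<integral>\<^sup>+ x. ennreal (\<bar>F n x\<bar> powr p) \<partial>M)"
      by (rule solves_norm_le[OF w l])
    also have "\<dots> \<le> B" unfolding B_def
    proof (rule nn_integral_mono_AE)
      show "AE x in M. ennreal (\<bar>F n x\<bar> powr p) \<le> ennreal (\<bar>H x\<bar> powr p)"
        using bd[of n] by eventually_elim (use p_ge in \<open>auto intro!: ennreal_leI powr_mono2\<close>)
    qed
    finally show ?thesis .
  qed
  have fatou: "(\<integral>\<^sup>+ x. liminf (\<lambda>n. ennreal (\<bar>w n x\<bar> powr p)) \<partial>M) \<le> B"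
  proof -
    have "(\<integral>\<^sup>+ x. liminf (\<lambda>n. ennreal (\<bar>w n x\<bar> powr p)) \<partial>M)
        \<le> liminf (\<lambda>n. \<integral>\<^sup>+ x. ennreal (\<bar>w n x\<bar> powr p) \<partial>M)"
      by (intro nn_integral_liminf) measurable
    also have "\<dots> \<le> limsup (\<lambda>n. \<integral>\<^sup>+ x. ennreal (\<bar>w n x\<bar> powr p) \<partial>M)"
      by (intro Liminf_le_Limsup) simp
    also have "\<dots> \<le> B" using wB by (intro Limsup_bounded) auto
    finally show ?thesis .
  qed
  have "AE x in M. liminf (\<lambda>n. ennreal (\<bar>w n x\<bar> powr p)) \<noteq> \<infinity>"
    using fatou B by (intro nn_integral_PInf_AE) auto
  then have conv: "AE x in M. convergent (\<lambda>n. w n x)"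
    using inc
  proof eventually_elim
    case (elim x)
    show ?case
    proof (rule ccontr)
      assume not: "\<not> convergent (\<lambda>n. w n x)"
      have "filterlim (\<lambda>n. w n x) at_top sequentially"
      proof (rule filterlim_at_top[THEN iffD2], rule allI)
        fix Z :: real
        have "\<exists>n. Z < w n x"
        proof (rule ccontr)
          assume "\<not> ?thesis"
          then have "\<And>n. w n x \<le> Z" by (simp add: not_less)
          then show False using not elim(2) by (metis incseq_convergent convergentI)
        qed
        then obtain n where "Z < w n x" by blast
        then have "Z \<le> w i x" if "n \<le> i" for i
          using incseqD[OF elim(2) that] by simp
        then show "eventually (\<lambda>n. Z \<le> w n x) sequentially"
          unfolding eventually_sequentially by blast
      qed
      then have abs_top: "filterlim (\<lambda>n. \<bar>w n x\<bar>) at_top sequentially"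
        by (rule filterlim_at_top_mono) (intro always_eventually allI abs_ge_self)
      then have "eventually (\<lambda>n. 1 \<le> \<bar>w n x\<bar>) sequentially"
        by (simp add: filterlim_at_top)
      then have "eventually (\<lambda>n. \<bar>w n x\<bar> \<le> \<bar>w n x\<bar> powr p) sequentially"
      proof eventually_elim
        case (elim n)
        then show ?case using powr_mono[of 1 p "\<bar>w n x\<bar>"] p_ge by simp
      qed
      with abs_top have "filterlim (\<lambda>n. \<bar>w n x\<bar> powr p) at_top sequentially"
        by (rule filterlim_at_top_mono)
      then have "(\<lambda>n. ennreal (\<bar>w n x\<bar> powr p)) \<longlonglongrightarrow> \<infinity>"
        by (simp add: ennreal_tendsto_top_eq_at_top infinity_ennreal_def)
      then have "liminf (\<lambda>n. ennreal (\<bar>w n x\<bar> powr p)) = \<infinity>"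
        by (intro lim_imp_Liminf) auto
      then show False using elim(1) by simp
    qed
  qed
  define u where "u x = lim (\<lambda>n. w n x)" for x
  have [measurable]: "u \<in> borel_measurable M" unfolding u_def by measurable
  have wu: "AE x in M. (\<lambda>n. w n x) \<longlonglongrightarrow> u x"
    using conv by eventually_elim (simp add: u_def convergent_LIMSEQ_iff)
  have up: "u \<in> Lp_fun M p"
  proof -
    have "(\<integral>\<^sup>+ x. ennreal (\<bar>u x\<bar> powr p) \<partial>M) = (\<integral>\<^sup>+ x. liminf (\<lambda>n. ennreal (\<bar>w n x\<bar> powr p)) \<partial>M)"
    proof (rule nn_integral_cong_AE)
      show "AE x in M. ennreal (\<bar>u x\<bar> powr p) = liminf (\<lambda>n. ennreal (\<bar>w n x\<bar> powr p))"
        using wu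
      proof eventually_elim
        case (elim x)
        have "(\<lambda>n. ennreal (\<bar>w n x\<bar> powr p)) \<longlonglongrightarrow> ennreal (\<bar>u x\<bar> powr p)"
          using elim p_ge by (intro tendsto_ennrealI tendsto_powr' tendsto_rabs) auto
        then show ?case by (intro lim_imp_Liminf[symmetric]) auto
      qed
    qed
    then have "(\<integral>\<^sup>+ x. ennreal (\<bar>u x\<bar> powr p) \<partial>M) < \<infinity>" using fatou B by simp
    then show ?thesis by (simp add: Lp_fun_def integrable_iff_bounded)
  qed
  have "AE x in M. (\<lambda>n. lap (w n) x) \<longlonglongrightarrow> lap u x"
  proof (rule lap_tendsto[OF _ _ _ _ wu])
    show "(\<lambda>x. \<bar>w 0 x\<bar> + \<bar>u x\<bar>) \<in> Lp_fun M p"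
      using wp up p_ge by (intro Lp_fun_add Lp_fun_abs) auto
    show "AE x in M. \<forall>n. \<bar>w n x\<bar> \<le> \<bar>w 0 x\<bar> + \<bar>u x\<bar>"
      using inc wu
    proof eventually_elim
      case (elim x)
      show ?case
      proof
        fix n
        show "\<bar>w n x\<bar> \<le> \<bar>w 0 x\<bar> + \<bar>u x\<bar>"
          using incseqD[OF elim(1), of 0 n] incseq_le[OF elim, of n] by auto
      qed
    qed
  qed measurable
  moreover have "AE x in M. \<forall>n. w n x + l * oper (w n) x = F n x"
    using w by (simp add: solves_def AE_all_countable)
  ultimately have "AE x in M. u x + l * oper u x = H x"
    using wu lim
  proof eventually_elim
    case (elim x)
    have "(\<lambda>n. w n x + l * oper (w n) x) \<longlonglongrightarrow> u x + l * oper u x"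
      unfolding oper_def using elim by (intro tendsto_intros) auto
    then show ?case using elim(2,4) by (auto intro: LIMSEQ_unique)
  qed
  then show ?thesis using up by (auto simp: solves_def)
qed

lemma solves_minus: "solves l H u \<Longrightarrow> solves l (\<lambda>x. - H x) (\<lambda>x. - u x)"
  unfolding solves_def
  using Lp_fun_scale[of u M p "-1"] by (auto simp: oper_minus elim!: eventually_mono)

text \<open>
  Data bounded below are increasing limits of bounded data. For general data the lower truncations
  decrease, which becomes an increasing limit after a change of sign.
\<close>

theorem resolvent_solvable:
  assumes H: "H \<in> Lp_fun M p" and l: "0 < l"
  shows "\<exists>u. solves l H u"
proof -
  note [measurable] = Lp_fun_measurable[OF H]
  have eventually_const: "eventually (\<lambda>n. \<bar>c\<bar> \<le> real n) sequentially" for c :: real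
    using filterlim_real_sequentially by (auto simp: filterlim_at_top)
  have below: "\<exists>u. solves l G u" if G: "G \<in> Lp_fun M p" and c: "\<And>x. c \<le> G x" for G and c :: real
  proof (rule solvable_incseq_limit[OF G l])
    note [measurable] = Lp_fun_measurable[OF G]
    show "\<exists>u. solves l (\<lambda>x. min (G x) (real n)) u" for n
    proof (rule solvable_bounded[OF _ _ l])
      show "\<bar>min (G x) (real n)\<bar> \<le> max \<bar>c\<bar> (real n)" for x using c[of x] by auto
    qed measurable
    show "AE x in M. (\<lambda>n. min (G x) (real n)) \<longlonglongrightarrow> G x"
    proof (rule AE_I2, rule tendsto_eventually)
      show "eventually (\<lambda>n. min (G x) (real n) = G x) sequentially" for x
        using eventually_const[of "G x"] by eventually_elim auto
    qed
  qed auto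
  have "\<exists>u. solves l (\<lambda>x. - H x) u"
  proof (rule solvable_incseq_limit[OF _ l])
    show "(\<lambda>x. - H x) \<in> Lp_fun M p" using Lp_fun_scale[OF H, of "-1"] by simp
    show "\<exists>u. solves l (\<lambda>x. - max (H x) (- real n)) u" for n
    proof -
      have "(\<lambda>x. max (H x) (- real n)) \<in> Lp_fun M p"
        using p_ge by (intro Lp_fun_dominated[OF H]) auto
      then have "\<exists>u. solves l (\<lambda>x. max (H x) (- real n)) u" by (rule below[of _ "- real n"]) auto
      then show ?thesis using solves_minus by blast
    qed
    show "AE x in M. (\<lambda>n. - max (H x) (- real n)) \<longlonglongrightarrow> - H x"
    proof (rule AE_I2, rule tendsto_eventually)
      show "eventually (\<lambda>n. - max (H x) (- real n) = - H x) sequentially" for x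
        using eventually_const[of "H x"] by eventually_elim auto
    qed
  qed auto
  then show ?thesis using solves_minus by fastforce
qed

end

section \<open>Radial kernels\<close>

lemma AE_lborel_affine_iff:
  fixes t :: "'a::euclidean_space"
  assumes "c \<noteq> 0" and P: "Measurable.pred borel P"
  shows "(AE y in lborel. P y) \<longleftrightarrow> (AE z in lborel. P (t + c *\<^sub>R z))"
proof -
  note [measurable] = P
  have "(AE y in lborel. P y) \<longleftrightarrow> (AE y in distr lborel borel (\<lambda>z. t + c *\<^sub>R z). P y)"
    by (subst lborel_affine[OF assms(1), of t]) (use assms(1) in \<open>simp add: AE_density\<close>)
  also have "\<dots> \<longleftrightarrow> (AE z in lborel. P (t + c *\<^sub>R z))"
    by (rule AE_distr_iff) measurable
  finally show ?thesis .
qed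

text \<open>
  The exceptional set is a union of spheres about \<open>x\<close> with radii in a null set. On each ray
  almost every scaling factor avoids \<open>N\<close>, so by Fubini some nonzero factor \<open>s\<close> is good for almost
  every point at once; the dilation by \<open>s\<close> preserves null sets and removes the factor.
\<close>

lemma AE_dist_notin_null_set:
  fixes x :: "'a::euclidean_space" and N :: "real set"
  assumes N: "N \<in> null_sets lborel"
  shows "AE y in lborel. norm (x - y) \<notin> N"
proof -
  have [measurable]: "N \<in> sets borel" using N by (simp add: null_sets_def)
  have scale: "AE s in lborel. s * c \<notin> N" if "c \<noteq> 0" for c :: real
  proof -
    have "AE r in lborel. r \<notin> N" using N by (rule AE_not_in)
    then have "AE s in lborel. 0 + c *\<^sub>R s \<notin> N"
      by (subst (asm) AE_lborel_affine_iff[OF that, of _ 0]) auto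
    then show ?thesis by (simp add: mult.commute)
  qed
  have "AE z in lborel. AE s in lborel. \<bar>s\<bar> * norm (z :: 'a) \<notin> N"
    using AE_lborel_singleton[of "0::'a"]
  proof eventually_elim
    case (elim z)
    have "AE s in lborel. s * norm z \<notin> N" "AE s in lborel. s * (- norm z) \<notin> N"
      using elim by (intro scale, simp)+
    then show ?case by eventually_elim (auto simp: abs_if)
  qed
  then have "AE s in lborel. AE z in lborel. \<bar>s\<bar> * norm (z :: 'a) \<notin> N"
    by (subst (asm) lborel_pair.AE_commute) measurable
  then have "AE s in lborel. s \<noteq> 0 \<and> (AE z in lborel. \<bar>s\<bar> * norm (z :: 'a) \<notin> N)"
    using AE_lborel_singleton[of "0::real"] by eventually_elim simp
  moreover have "ae_filter (lborel :: real measure) \<noteq> bot"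
    by (simp add: ae_filter_eq_bot_iff)
  ultimately obtain s :: real where s: "s \<noteq> 0" "AE z in lborel. \<bar>s\<bar> * norm (z :: 'a) \<notin> N"
    using eventually_happens' by blast
  show ?thesis
    by (subst AE_lborel_affine_iff[OF s(1), of _ x]) (use s(2) in \<open>auto\<close>)
qed

lemma AE_lebesgue_onI:
  assumes "S \<in> sets lebesgue" "AE x in lborel. x \<in> S \<longrightarrow> P x"
  shows "AE x in lebesgue_on S. P x"
  using assms by (simp add: AE_restrict_space_iff AE_completion)

lemma AE_lebesgue_onD:
  assumes "S \<in> sets lebesgue" "AE x in lebesgue_on S. P x"
  shows "AE x in lborel. x \<in> S \<longrightarrow> P x"
  using assms by (simp add: AE_restrict_space_iff AE_completion_iff)

text \<open>
  Joint measurability of \<open>(x, y) \<mapsto> K(\<bar>x - y\<bar>)\<close> for the product of two completed measures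
  needs a Borel profile: a preimage of a Lebesgue null set need not lie in the product
  \<open>\<sigma>\<close>-algebra.
\<close>

lemma radial_kernel_borel:
  fixes K :: "real \<Rightarrow> real"
  assumes K: "K \<in> Linfty {0..}" and K_nonneg: "\<And>r. r \<ge> 0 \<Longrightarrow> K r \<ge> 0"
  obtains K' C where "K' \<in> borel_measurable borel" "\<And>r. 0 \<le> K' r" "\<And>r. K' r \<le> C"
    "\<And>x :: 'a::euclidean_space. AE y in lborel. K (norm (x - y)) = K' (norm (x - y))"
proof -
  obtain C where C: "AE r in lebesgue_on {0..}. \<bar>K r\<bar> \<le> C" using K by (auto simp: Linfty_def)
  have "(\<lambda>r. if r \<in> {0..} then K r else 0) \<in> borel_measurable lebesgue"
    using K by (intro borel_measurable_if_I) (auto simp: Linfty_def)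
  then obtain G where [measurable]: "G \<in> borel_measurable lborel"
    and G: "AE r in lborel. (if r \<in> {0..} then K r else 0) = G r"
    using completion_ex_borel_measurable_real by blast
  (* Truncation enforces the bounds everywhere and changes G only on a null set of radii r \<ge> 0. *)
  define K' where "K' r = max 0 (min \<bar>C\<bar> (G r))" for r
  have "AE r in lborel. r \<in> {0..} \<longrightarrow> \<bar>K r\<bar> \<le> C"
    using C by (intro AE_lebesgue_onD) auto
  with G have "AE r in lborel. 0 \<le> r \<longrightarrow> K r = K' r"
  proof eventually_elim
    case (elim r)
    then show ?case using K_nonneg[of r] by (auto simp: K'_def)
  qed
  then obtain N where N: "\<And>r. r \<in> space lborel - N \<Longrightarrow> 0 \<le> r \<longrightarrow> K r = K' r" "N \<in> null_sets lborel"
    by (rule AE_E3) blast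
  show ?thesis
  proof
    show "K' \<in> borel_measurable borel" unfolding K'_def by measurable
    show "0 \<le> K' r" "K' r \<le> \<bar>C\<bar>" for r by (auto simp: K'_def)
    show "AE y in lborel. K (norm (x - y)) = K' (norm (x - y))" for x :: 'a
      using AE_dist_notin_null_set[OF N(2), of x] by eventually_elim (simp add: N(1))
  qed
qed

text \<open>
  By completeness of the Lebesgue measure.
\<close>

lemma lebesgue_on_measurable_AE_cong:
  fixes f g :: "'a::euclidean_space \<Rightarrow> real"
  assumes S: "S \<in> sets lebesgue" and f: "f \<in> borel_measurable (lebesgue_on S)"
    and fg: "AE x in lebesgue_on S. f x = g x"
  shows "g \<in> borel_measurable (lebesgue_on S)"
proof (rule measurableI)
  fix B :: "real set" assume B: "B \<in> sets borel"
  let ?F = "{x \<in> S. f x \<in> B}" and ?G = "{x \<in> S. g x \<in> B}"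
  have "?F \<in> sets (lebesgue_on S)"
    using measurable_sets[OF f B] by (simp add: vimage_def Int_def conj_commute)
  then have "?F \<in> sets lebesgue" using S by (simp add: sets_restrict_space_iff)
  then have "?G \<in> sets lebesgue"
  proof (rule completion.in_sets_AE[rotated])
    show "AE x in lebesgue. x \<in> ?F \<longleftrightarrow> x \<in> ?G"
      using fg S by (simp add: AE_restrict_space_iff) (auto elim: eventually_mono)
  qed auto
  then show "g -` B \<inter> space (lebesgue_on S) \<in> sets (lebesgue_on S)"
    using S by (simp add: sets_restrict_space_iff vimage_def Int_def conj_commute)
qed simp

section \<open>Order-preserving operators are multiplications\<close>

lemma Lp_eq_Lp_fun: "Lp p S = Lp_fun (lebesgue_on S) p"
  by (simp add: Lp_def Lp_fun_def)

text \<open>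
  The adjoint is only known through its pairing, and so is the linearity of \<open>A\<^sup>* A\<close>: the
  defect \<open>d\<close> is orthogonal to every square-integrable function, in particular to itself.
\<close>

lemma adjoint_composition_affine:
  fixes u :: "'a::euclidean_space \<Rightarrow> real"
  assumes A: "L2_bounded_linear S A" and As: "L2_adjoint S A As"
    and u: "u \<in> Lp 2 S" and e: "e \<in> Lp 2 S"
  shows "AE x in lebesgue_on S. As (A (\<lambda>x. u x - c * e x)) x = As (A u) x - c * As (A e) x"
proof -
  let ?M = "lebesgue_on S" and ?w = "\<lambda>x. u x - c * e x"
  have A_map: "A v \<in> Lp 2 S" if "v \<in> Lp 2 S" for v
    using A that by (auto simp: L2_bounded_linear_def Lp_map_def)
  have As_map: "As v \<in> Lp 2 S" if "v \<in> Lp 2 S" for v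
    using As that by (auto simp: L2_adjoint_def Lp_map_def)
  have adj: "(LINT x|?M. A v x * y x) = (LINT x|?M. v x * As y x)"
    if "v \<in> Lp 2 S" "y \<in> Lp 2 S" for v y
    using As that by (auto simp: L2_adjoint_def)
  have w: "?w \<in> Lp 2 S"
    using u e unfolding Lp_eq_Lp_fun by (intro Lp_fun_diff Lp_fun_scale) auto
  have "ae_eq S (A (\<lambda>x. 1 * u x + (- c) * e x)) (\<lambda>x. 1 * A u x + (- c) * A e x)"
    using A u e unfolding L2_bounded_linear_def by blast
  then have Aw: "AE x in ?M. A ?w x = A u x - c * A e x" by (simp add: ae_eq_def)
  define d where "d x = As (A ?w) x - (As (A u) x - c * As (A e) x)" for x
  have d: "d \<in> Lp 2 S"
    unfolding d_def Lp_eq_Lp_fun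
    using As_map[OF A_map] u e w unfolding Lp_eq_Lp_fun
    by (intro Lp_fun_diff Lp_fun_scale) auto
  have prod: "integrable ?M (\<lambda>x. v x * y x)" if "v \<in> Lp 2 S" "y \<in> Lp 2 S" for v y
    using that by (intro L2_mult_integrable) (auto simp: Lp_eq_Lp_fun)
  note ints = prod[OF d As_map[OF A_map[OF w]]] prod[OF d As_map[OF A_map[OF u]]]
    prod[OF d As_map[OF A_map[OF e]]]
  note ints' = prod[OF A_map[OF d] A_map[OF w]] prod[OF A_map[OF d] A_map[OF u]]
    prod[OF A_map[OF d] A_map[OF e]]
  have "(LINT x|?M. d x * d x)
      = (LINT x|?M. d x * As (A ?w) x - (d x * As (A u) x - c * (d x * As (A e) x)))"
    by (intro Bochner_Integration.integral_cong refl) (simp add: d_def algebra_simps)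
  also have "\<dots> = (LINT x|?M. A d x * A ?w x) - ((LINT x|?M. A d x * A u x) - c * (LINT x|?M. A d x * A e x))"
    using ints by (simp add: adj d w u e A_map)
  also have "\<dots> = (LINT x|?M. A d x * A ?w x - (A d x * A u x - c * (A d x * A e x)))"
    using ints' by simp
  also have "\<dots> = (LINT x|?M. 0)"
  proof (rule integral_cong_AE)
    show "AE x in ?M. A d x * A ?w x - (A d x * A u x - c * (A d x * A e x)) = 0"
      using Aw
    proof eventually_elim
      case (elim x)
      show ?case unfolding elim by (simp add: algebra_simps)
    qed
  qed (use ints' in \<open>auto dest!: borel_measurable_integrable\<close>)
  finally have "(LINT x|?M. d x * d x) = 0" by simp
  then have "AE x in ?M. d x * d x = 0"
    using prod[OF d d] by (subst (asm) integral_nonneg_eq_0_iff_AE) auto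
  then show ?thesis by eventually_elim (simp add: d_def)
qed

text \<open>
  Apply the sign condition to \<open>u - c\<close> for all rational \<open>c\<close> at once. If \<open>u\<close> and
  \<open>A\<^sup>* A u / A\<^sup>* A 1\<close> differed at a point, a rational strictly between them would give
  opposite signs there.
\<close>

lemma order_preserving_multiplication:
  fixes u :: "'a::euclidean_space \<Rightarrow> real"
  assumes A: "L2_bounded_linear S A" and As: "L2_adjoint S A As"
    and op: "order_preserving S (\<lambda>u. As (A u))"
    and u: "u \<in> Lp 2 S" and one: "(\<lambda>_. 1) \<in> Lp 2 S"
  shows "AE x in lebesgue_on S. 0 < As (A (\<lambda>_. 1)) x \<and> As (A u) x = As (A (\<lambda>_. 1)) x * u x"
proof -
  let ?M = "lebesgue_on S" and ?m = "As (A (\<lambda>_. 1))"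
  have "AE x in ?M. sgn (?m x) = sgn (1::real)"
    using op one unfolding order_preserving_def by fast
  moreover have "AE x in ?M. \<forall>c\<in>\<rat>. sgn (As (A u) x - c * ?m x) = sgn (u x - c)"
  proof (subst AE_ball_countable[OF countable_rat], rule ballI)
    fix c :: real
    have "(\<lambda>x. u x - c * 1) \<in> Lp 2 S"
      using u one unfolding Lp_eq_Lp_fun by (intro Lp_fun_diff Lp_fun_scale) auto
    then have "AE x in ?M. sgn (As (A (\<lambda>x. u x - c * 1)) x) = sgn (u x - c * 1)"
      using op unfolding order_preserving_def by blast
    with adjoint_composition_affine[OF A As u one, of c]
    show "AE x in ?M. sgn (As (A u) x - c * ?m x) = sgn (u x - c)"
      by eventually_elim simp
  qed
  ultimately show ?thesis
  proof eventually_elim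
    case (elim x)
    have m: "0 < ?m x" using elim(1) by (simp add: sgn_1_pos)
    have "As (A u) x / ?m x = u x"
    proof (rule ccontr)
      assume "As (A u) x / ?m x \<noteq> u x"
      then consider "As (A u) x / ?m x < u x" | "u x < As (A u) x / ?m x" by linarith
      then show False
      proof cases
        case 1
        then obtain c where c: "c \<in> \<rat>" "As (A u) x / ?m x < c" "c < u x"
          using Rats_dense_in_real by blast
        then have "sgn (As (A u) x - c * ?m x) = -1" "sgn (u x - c) = 1"
          using m by (auto simp: sgn_if pos_divide_less_eq)
        then show False using elim(2) c by simp
      next
        case 2
        then obtain c where c: "c \<in> \<rat>" "u x < c" "c < As (A u) x / ?m x"
          using Rats_dense_in_real by blast
        then have "sgn (As (A u) x - c * ?m x) = 1" "sgn (u x - c) = -1"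
          using m by (auto simp: sgn_if pos_less_divide_eq)
        then show False using elim(2) c by simp
      qed
    qed
    then show ?case using m by (simp add: field_simps)
  qed
qed

section \<open>The evolution operator\<close>

theorem proposition3p3:
  fixes \<Omega> :: "'a::euclidean_space set"
    and \<mu> p q :: real
    and K :: "real \<Rightarrow> real"
    and A As :: "('a \<Rightarrow> real) \<Rightarrow> ('a \<Rightarrow> real)"
    and f :: "'a \<Rightarrow> real"
  assumes "open \<Omega>" and "bounded \<Omega>"
    and "\<mu> > 0" and "p \<ge> 2" and "q = p / (p - 1)"
    and "L2_bounded_linear \<Omega> A" and "L2_adjoint \<Omega> A As"
    and "order_preserving \<Omega> (\<lambda>u. As (A u))"
    and "\<And>r. r \<ge> 0 \<Longrightarrow> K r \<ge> 0" and "K \<in> Linfty {0..}"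
    and "f \<in> Lp p \<Omega>"
  shows "Lp_map \<Omega> p q (evolution_operator \<Omega> \<mu> p K A As f)
    \<and> completely_accretive \<Omega> (operator_of \<Omega> p q (evolution_operator \<Omega> \<mu> p K A As f))
    \<and> (\<forall>l > 0. Lp p \<Omega> \<subseteq> op_ran (Id_plus l (operator_of \<Omega> p q (evolution_operator \<Omega> \<mu> p K A As f))))"
proof -
  let ?M = "lebesgue_on \<Omega>"
  define E where "E = evolution_operator \<Omega> \<mu> p K A As f"
  have \<Omega>_leb: "\<Omega> \<in> sets lebesgue" using \<open>open \<Omega>\<close> by auto
  have "\<Omega> \<in> lmeasurable" using \<open>open \<Omega>\<close> \<open>bounded \<Omega>\<close> by (simp add: lmeasurable_open)
  then interpret fin: finite_measure ?M by (rule finite_measure_lebesgue_on)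
  obtain K' C where K': "K' \<in> borel_measurable borel" "\<And>r. 0 \<le> K' r" "\<And>r. K' r \<le> C"
    "\<And>x :: 'a. AE y in lborel. K (norm (x - y)) = K' (norm (x - y))"
    using radial_kernel_borel[OF assms(10,9)] by blast
  note K'(1)[measurable]
  have p: "2 \<le> p" "0 \<le> p" "1 \<le> p" and q: "0 \<le> q" "1 \<le> q" "q \<le> 2" "q \<le> p"
  proof -
    show "2 \<le> p" "0 \<le> p" "1 \<le> p" using \<open>p \<ge> 2\<close> by auto
    show "0 \<le> q" "1 \<le> q" "q \<le> 2" using \<open>p \<ge> 2\<close> by (auto simp: assms(5) field_simps)
    then show "q \<le> p" using \<open>p \<ge> 2\<close> by linarith
  qed
  have one: "(\<lambda>_. 1) \<in> Lp 2 \<Omega>" unfolding Lp_eq_Lp_fun by (rule fin.Lp_fun_bounded[of _ 1]) auto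
  have B_map: "As (A u) \<in> Lp 2 \<Omega>" if "u \<in> Lp 2 \<Omega>" for u
    using that assms(6,7) by (auto simp: L2_bounded_linear_def L2_adjoint_def Lp_map_def)
  have Lp2: "u \<in> Lp 2 \<Omega>" if "u \<in> Lp p \<Omega>" for u
    using that p unfolding Lp_eq_Lp_fun by (intro fin.Lp_fun_mono[of u p 2]) auto
  (* The positive part changes A* A 1 only on a null set and makes m nonnegative everywhere. *)
  define m where "m x = max 0 (As (A (\<lambda>_. 1)) x)" for x
  have m: "AE x in ?M. As (A u) x = m x * u x" if "u \<in> Lp 2 \<Omega>" for u
    using order_preserving_multiplication[OF assms(6-8) that one]
    by eventually_elim (auto simp: m_def)
  have m_meas [measurable]: "m \<in> borel_measurable ?M"
  proof -
    note [measurable] = Lp_fun_measurable[OF B_map[OF one, unfolded Lp_eq_Lp_fun]]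
    show ?thesis unfolding m_def by measurable
  qed
  interpret nonlocal_equation ?M "\<lambda>x y. K' (norm (x - y))" C p \<mu> m
  proof unfold_locales
    have id: "(\<lambda>x. x) \<in> ?M \<rightarrow>\<^sub>M borel"
      by (intro measurable_restrict_space1 measurable_completion) simp
    have [measurable]: "(\<lambda>z. fst z) \<in> ?M \<Otimes>\<^sub>M ?M \<rightarrow>\<^sub>M borel" "(\<lambda>z. snd z) \<in> ?M \<Otimes>\<^sub>M ?M \<rightarrow>\<^sub>M borel"
      using measurable_compose[OF measurable_fst id] measurable_compose[OF measurable_snd id] by blast+
    show "(\<lambda>(x, y). K' (norm (x - y))) \<in> borel_measurable (?M \<Otimes>\<^sub>M ?M)"
      unfolding case_prod_beta by measurable
    show "integrable ?M (\<lambda>x. m x * u x)" if "u \<in> Lp_fun ?M p" for u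
    proof -
      have u: "u \<in> Lp 2 \<Omega>" using that by (intro Lp2) (simp add: Lp_eq_Lp_fun)
      note [measurable] = Lp_fun_measurable[OF that]
      have "integrable ?M (As (A u))"
        using B_map[OF u] unfolding Lp_eq_Lp_fun by (rule fin.Lp_fun_integrable) simp
      then show ?thesis
        by (rule integrable_cong_AE_imp) (use m[OF u] in \<open>auto elim!: eventually_mono\<close>)
    qed
  qed (use K' assms(3) p in \<open>auto simp: m_def norm_minus_commute\<close>)
  have lap: "nonlocal_p_laplacian \<Omega> p K u x = lap u x" if u: "u \<in> borel_measurable ?M" and x: "x \<in> \<Omega>" for u x
  proof -
    note [measurable] = u
    have K_eq: "AE y in ?M. K' (norm (x - y)) = K (norm (x - y))"
      using K'(4)[of x] by (intro AE_lebesgue_onI[OF \<Omega>_leb]) (auto elim: eventually_mono)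
    have [measurable]: "(\<lambda>y. K' (norm (x - y))) \<in> borel_measurable ?M"
      using k_section[of x] x by simp
    then have [measurable]: "(\<lambda>y. K (norm (x - y))) \<in> borel_measurable ?M"
      using K_eq by (rule lebesgue_on_measurable_AE_cong[OF \<Omega>_leb])
    have "(LINT y|?M. K (norm (x - y)) * \<bar>u y - u x\<bar> powr (p - 2) * (u y - u x))
        = (LINT y|?M. K' (norm (x - y)) * pflux p (u y - u x))"
    proof (rule integral_cong_AE)
      show "AE y in ?M. K (norm (x - y)) * \<bar>u y - u x\<bar> powr (p - 2) * (u y - u x)
          = K' (norm (x - y)) * pflux p (u y - u x)"
        using K_eq by eventually_elim (simp add: pflux_def)
    qed measurable
    then show ?thesis by (simp add: nonlocal_p_laplacian_def lap_def)
  qed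
  have E_eq: "E u x = \<mu> * lap u x + As (A u) x - f x" if "u \<in> Lp p \<Omega>" "x \<in> \<Omega>" for u x
    using lap[of u x] that by (simp add: E_def evolution_operator_def Lp_def)
  have E_oper: "AE x in ?M. E u x = oper u x - f x" if u: "u \<in> Lp p \<Omega>" for u
    using m[OF Lp2[OF u]] AE_space by eventually_elim (simp add: E_eq[OF u] oper_def)
  have E_Lq: "E u \<in> Lp q \<Omega>" if u: "u \<in> Lp p \<Omega>" for u
  proof -
    have "lap u \<in> Lp_fun ?M q" using lap_in_dual[of u] u by (simp add: Lp_eq_Lp_fun assms(5))
    moreover have "As (A u) \<in> Lp_fun ?M q"
      using fin.Lp_fun_mono[of "As (A u)" 2 q] B_map[OF Lp2[OF u]] q by (simp add: Lp_eq_Lp_fun)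
    moreover have "f \<in> Lp_fun ?M q"
      using fin.Lp_fun_mono[of f p q] assms(11) q by (simp add: Lp_eq_Lp_fun)
    ultimately have sum: "(\<lambda>x. \<mu> * lap u x + As (A u) x - f x) \<in> Lp_fun ?M q"
      using q by (intro Lp_fun_diff Lp_fun_add Lp_fun_scale) auto
    then have "E u \<in> Lp_fun ?M q"
    proof (rule Lp_fun_dominated)
      have "E u \<in> borel_measurable ?M \<longleftrightarrow> (\<lambda>x. \<mu> * lap u x + As (A u) x - f x) \<in> borel_measurable ?M"
        by (rule measurable_cong) (simp add: E_eq[OF u])
      then show "E u \<in> borel_measurable ?M" using Lp_fun_measurable[OF sum] by blast
      show "AE x in ?M. \<bar>E u x\<bar> \<le> \<bar>\<mu> * lap u x + As (A u) x - f x\<bar>"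
        by (rule AE_I2) (simp add: E_eq[OF u])
    qed fact
    then show ?thesis by (simp add: Lp_eq_Lp_fun)
  qed
  have E_cong: "ae_eq \<Omega> (E u) (E v)" if u: "u \<in> Lp p \<Omega>" and v: "v \<in> Lp p \<Omega>" and "ae_eq \<Omega> u v" for u v
  proof -
    note [measurable] = u[unfolded Lp_eq_Lp_fun, THEN Lp_fun_measurable]
      v[unfolded Lp_eq_Lp_fun, THEN Lp_fun_measurable]
    have uv: "AE x in ?M. u x = v x" using that by (simp add: ae_eq_def)
    have "AE x in ?M. oper u x = oper v x"
      using uv AE_space
    proof eventually_elim
      case (elim x)
      then have [simp, measurable]: "x \<in> space ?M" by simp
      have "lap u x = lap v x"
        unfolding lap_def
      proof (intro arg_cong[where f = uminus] integral_cong_AE)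
        show "AE y in ?M. K' (norm (x - y)) * pflux p (u y - u x) = K' (norm (x - y)) * pflux p (v y - v x)"
          using uv by eventually_elim (simp add: elim)
      qed measurable
      then show ?case using elim by (simp add: oper_def)
    qed
    with E_oper[OF u] E_oper[OF v] show ?thesis
      unfolding ae_eq_def by eventually_elim simp
  qed
  have "completely_accretive \<Omega> (operator_of \<Omega> p q E)"
    unfolding completely_accretive_def sgt_le_def gph_def operator_of_def
  proof (safe)
    fix l :: real and v v' w w' :: "'a \<Rightarrow> real" and j
    assume l: "0 < l" and v: "v \<in> Lp p \<Omega>" and w: "w \<in> Lp p \<Omega>" and j: "j \<in> convex_lsc_class"
      and v': "ae_eq \<Omega> v' (E v)" and w': "ae_eq \<Omega> w' (E w)"
    have "(\<integral>\<^sup>+ x. j (v x - w x) \<partial>?M) \<le> (\<integral>\<^sup>+ x. j (v x - w x + l * (oper v x - oper w x)) \<partial>?M)"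
      using v w l j by (intro oper_contraction) (auto simp: Lp_eq_Lp_fun)
    also have "\<dots> = (\<integral>\<^sup>+ x. j (v x - w x + l * (v' x - w' x)) \<partial>?M)"
    proof (rule nn_integral_cong_AE)
      show "AE x in ?M. j (v x - w x + l * (oper v x - oper w x)) = j (v x - w x + l * (v' x - w' x))"
        using E_oper[OF v] E_oper[OF w] v'[unfolded ae_eq_def] w'[unfolded ae_eq_def]
        by eventually_elim simp
    qed
    finally show "(\<integral>\<^sup>+ x. j (v x - w x) \<partial>?M) \<le> (\<integral>\<^sup>+ x. j (v x - w x + l * (v' x - w' x)) \<partial>?M)" .
  qed
  moreover have range: "h \<in> op_ran (Id_plus l (operator_of \<Omega> p q E))" if l: "0 < l" and h: "h \<in> Lp p \<Omega>" for l h
  proof -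
    have "(\<lambda>x. h x + l * f x) \<in> Lp_fun ?M p"
      using h assms(11) p by (intro Lp_fun_add Lp_fun_scale) (auto simp: Lp_eq_Lp_fun)
    then obtain u where "solves l (\<lambda>x. h x + l * f x) u" using resolvent_solvable l by blast
    then have u: "u \<in> Lp p \<Omega>" and sol: "AE x in ?M. u x + l * oper u x = h x + l * f x"
      by (auto simp: solves_def Lp_eq_Lp_fun)
    (* The representative of E u for which u + l w = h holds at every point. *)
    define w where "w x = (1 / l) * (h x - u x)" for x
    have "w \<in> Lp_fun ?M p"
      unfolding w_def using h u p by (intro Lp_fun_scale Lp_fun_diff) (auto simp: Lp_eq_Lp_fun)
    then have "w \<in> Lp q \<Omega>" unfolding Lp_eq_Lp_fun using q by (intro fin.Lp_fun_mono[of w p q]) auto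
    moreover have "ae_eq \<Omega> w (E u)"
      unfolding ae_eq_def using sol E_oper[OF u]
    proof eventually_elim
      case (elim x)
      have "h x - u x = l * E u x" unfolding elim(2) using elim(1) by (simp add: algebra_simps)
      then show ?case using l by (simp add: w_def)
    qed
    ultimately have "w \<in> operator_of \<Omega> p q E u" using u by (simp add: operator_of_def)
    moreover have "h = (\<lambda>x. u x + l * w x)" using l by (simp add: w_def)
    ultimately show ?thesis unfolding op_ran_def Id_plus_def by blast
  qed
  moreover have "Lp_map \<Omega> p q E" unfolding Lp_map_def using E_Lq E_cong by simp
  ultimately show ?thesis unfolding E_def[symmetric] by (intro conjI allI impI subsetI)
qed

end
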